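(* Let $(X,\xi)$ and $(Y,\zeta)$ be finite $F$-coalgebras and let $\epsilon\ge0$. If $\Lambda$ is polynomial-time solvable, then both the winning region of Spoiler in the codensity game up to $\epsilon$ on $\xi$ and $\zeta$, and a history-free winning strategy for Spoiler on that winning region, are computable in polynomial time.
   Context: Let $\mathcal V=[0,1]$ and let $F$ be a set functor. Coalgebras are maps $\xi\colon X\to FX$, finite if $X$ is finite. Fix a set $\Lambda$ of monotone $2$-to-$\mathcal V$ predicate liftings, i.e. natural families $\lambda_X\colon 2^X\to\mathcal V^{FX}$ ($\lambda_Y(A)(Ff(a))=\lambda_X(f^{-1}[A])(a)$) monotone in $A$. $\Lambda$ is polynomial-time solvable if, given $\epsilon\ge0$, $a\in FX$, $b\in FY$ and a relation $S\subseteq X\times Y$, one can decide in time polynomial in the total input size ($\epsilon$ in binary) whether there exist $A\subseteq X$, $B\subseteq Y$ and $\lambda\in\Lambda$ with $\lambda_Y(B)(b)<\lambda_X(A)(a)-\epsilon$ and $A\times(Y\setminus B)\subseteq S$, and in that case compute such data in polynomial time. Codensity game up to $\epsilon$ on $\xi,\zeta$: - Spoiler owns positions $(x,y)\in X\times Y$ and moves to $(A,B)\in2^X\times2^Y$ with $\lambda_Y(B)(\zeta(y))<\lambda_X(A)(\xi(x))-\epsilon$ for some $\lambda\in\Lambda$. - Duplicator owns positions $(A,B)$ and moves to $(x',y')$ with $x'\in A$ and $y'\notin B$. - A player who cannot move loses, and infinite plays are won by Duplicator. *)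

theory Defs
  imports "HOL-Computational_Algebra.Polynomial" "HOL-Library.FuncSet"
begin

text \<open>
  The model of computation is Jones' WHILE language: imperative programs with finitely many
  variables that hold binary trees. An assignment is charged the size of the tree it stores (and
  not just one unit), so a run of cost t only handles trees of total size at most the input size
  plus t plus the number of variables. Hence the model and multi-tape Turing machines simulate
  each other with polynomial overhead.
\<close>

datatype data = Leaf | Node data data

primrec data_size :: "data \<Rightarrow> nat" where
  "data_size Leaf = 1"
| "data_size (Node d e) = Suc (data_size d + data_size e)"

fun left :: "data \<Rightarrow> data" where
  "left Leaf = Leaf"
| "left (Node d e) = d"

fun right :: "data \<Rightarrow> data" where
  "right Leaf = Leaf"
| "right (Node d e) = e"

type_synonym var = nat
type_synonym store = "var \<Rightarrow> data"

datatype com =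
    Set_Leaf var
  | Copy var var
  | Make_Node var var var
  | Take_Left var var
  | Take_Right var var
  | Seq com com
  | If_Node var com com
  | While_Node var com

text \<open>\<open>exec c s t s'\<close>: started in \<open>s\<close>, program \<open>c\<close> terminates in \<open>s'\<close> with cost \<open>t\<close>.\<close>

inductive exec :: "com \<Rightarrow> store \<Rightarrow> nat \<Rightarrow> store \<Rightarrow> bool" where
  Set_Leaf: "exec (Set_Leaf x) s (Suc (data_size Leaf)) (s(x := Leaf))"
| Copy: "exec (Copy x y) s (Suc (data_size (s y))) (s(x := s y))"
| Make_Node: "exec (Make_Node x y z) s (Suc (data_size (Node (s y) (s z)))) (s(x := Node (s y) (s z)))"
| Take_Left: "exec (Take_Left x y) s (Suc (data_size (left (s y)))) (s(x := left (s y)))"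
| Take_Right: "exec (Take_Right x y) s (Suc (data_size (right (s y)))) (s(x := right (s y)))"
| Seq: "exec c1 s t1 s' \<Longrightarrow> exec c2 s' t2 s'' \<Longrightarrow> exec (Seq c1 c2) s (t1 + t2) s''"
| If_True: "s x \<noteq> Leaf \<Longrightarrow> exec c1 s t s' \<Longrightarrow> exec (If_Node x c1 c2) s (Suc t) s'"
| If_False: "s x = Leaf \<Longrightarrow> exec c2 s t s' \<Longrightarrow> exec (If_Node x c1 c2) s (Suc t) s'"
| While_True: "s x \<noteq> Leaf \<Longrightarrow> exec c s t1 s' \<Longrightarrow> exec (While_Node x c) s' t2 s'' \<Longrightarrow>
    exec (While_Node x c) s (Suc (t1 + t2)) s''"
| While_False: "s x = Leaf \<Longrightarrow> exec (While_Node x c) s 1 s"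

inductive_cases exec_cases:
  "exec (Set_Leaf x) s t s'"
  "exec (Copy x y) s t s'"
  "exec (Make_Node x y z) s t s'"
  "exec (Take_Left x y) s t s'"
  "exec (Take_Right x y) s t s'"
  "exec (Seq c1 c2) s t s'"
  "exec (If_Node x c1 c2) s t s'"
  "exec (While_Node x c) s t s'"

lemma exec_deterministic:
  "exec c s t s' \<Longrightarrow> exec c s u s'' \<Longrightarrow> u = t \<and> s'' = s'"
proof (induction arbitrary: u s'' rule: exec.induct)
  case (Set_Leaf x s)
  then show ?case by (rule exec_cases(1)) simp
next
  case (Copy x y s)
  then show ?case by (rule exec_cases(2)) simp
next
  case (Make_Node x y z s)
  then show ?case by (rule exec_cases(3)) simp
next
  case (Take_Left x y s)
  then show ?case by (rule exec_cases(4)) simp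
next
  case (Take_Right x y s)
  then show ?case by (rule exec_cases(5)) simp
next
  case (Seq c1 s t1 s' c2 t2 s3)
  from Seq.prems show ?case
    by (rule exec_cases(6)) (blast dest: Seq.IH)
next
  case (If_True s x c1 t s' c2)
  from If_True.prems show ?case
    by (rule exec_cases(7)) (use If_True in blast)+
next
  case (If_False s x c2 t s' c1)
  from If_False.prems show ?case
    by (rule exec_cases(7)) (use If_False in blast)+
next
  case (While_True s x c t1 s' t2 s3)
  from While_True.prems show ?case
    by (rule exec_cases(8)) (use While_True.hyps While_True.IH in blast)+
next
  case (While_False s x c)
  from While_False.prems show ?case
    by (rule exec_cases(8)) (use While_False.hyps in auto)
qed

text \<open>Input and output are passed in variable 0; all other variables are initially \<open>Leaf\<close>.\<close>

definition initial_store :: "data \<Rightarrow> store" where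
  "initial_store d = (\<lambda>_. Leaf)(0 := d)"

text \<open>
  A coding relates a tree \<open>d\<close> to the object it stands for. Objects need not have a code (there
  are, e.g., only countably many codes but uncountably many probability distributions), and may
  have several (e.g. a finite set has one for each enumeration of it).
\<close>

type_synonym 'a coding = "data \<Rightarrow> 'a \<Rightarrow> bool"

text \<open>
  Computational problems, including search problems: \<open>inp d i\<close> says that \<open>d\<close> codes the instance
  \<open>i\<close>, and \<open>sol i e\<close> that \<open>e\<close> codes an admissible output for \<open>i\<close>.
\<close>

definition poly_time_computable :: "'i coding \<Rightarrow> ('i \<Rightarrow> data \<Rightarrow> bool) \<Rightarrow> bool" where
  "poly_time_computable inp sol \<longleftrightarrow>
     (\<exists>(c :: com) (p :: nat poly). \<forall>d i. inp d i \<longrightarrow>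
        (\<exists>t s. exec c (initial_store d) t s \<and> t \<le> poly p (data_size d) \<and> sol i (s 0)))"

fun data_list :: "data list \<Rightarrow> data" where
  "data_list [] = Leaf"
| "data_list (d # ds) = Node d (data_list ds)"

definition code_pair :: "'a coding \<Rightarrow> 'b coding \<Rightarrow> ('a \<times> 'b) coding" where
  "code_pair R S d p \<longleftrightarrow> (\<exists>d1 d2. d = Node d1 d2 \<and> R d1 (fst p) \<and> S d2 (snd p))"

text \<open>Finite sets are coded by enumerations without repetitions.\<close>

definition code_set :: "'a coding \<Rightarrow> 'a set coding" where
  "code_set R d A \<longleftrightarrow>
     (\<exists>ds as. d = data_list ds \<and> list_all2 R ds as \<and> distinct as \<and> set as = A)"

definition code_by :: "('a \<Rightarrow> data) \<Rightarrow> 'a coding" where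
  "code_by f d a \<longleftrightarrow> d = f a"

fun bits :: "nat \<Rightarrow> bool list" where
  "bits n = (if n = 0 then [] else odd n # bits (n div 2))"

declare bits.simps [simp del]

definition data_nat :: "nat \<Rightarrow> data" where
  "data_nat n = data_list (map (\<lambda>b. if b then Node Leaf Leaf else Leaf) (bits n))"

text \<open>Only used for nonnegative rationals, so no sign is stored.\<close>

definition data_rat :: "rat \<Rightarrow> data" where
  "data_rat q = Node (data_nat (nat (fst (quotient_of q)))) (data_nat (nat (snd (quotient_of q))))"

text \<open>
  Sets are the subsets of an arbitrary type \<open>'u\<close>. The action \<open>Fm X Y f\<close> on a map \<open>f\<close> from \<open>X\<close>
  to \<open>Y\<close> may depend on \<open>f\<close> only through its values on \<open>X\<close>.
\<close>

locale set_functor =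
  fixes F :: "'u set \<Rightarrow> 'f set"
    and Fm :: "'u set \<Rightarrow> 'u set \<Rightarrow> ('u \<Rightarrow> 'u) \<Rightarrow> 'f \<Rightarrow> 'f"
  assumes map_closed: "f \<in> X \<rightarrow> Y \<Longrightarrow> a \<in> F X \<Longrightarrow> Fm X Y f a \<in> F Y"
    and map_cong: "f \<in> X \<rightarrow> Y \<Longrightarrow> (\<And>x. x \<in> X \<Longrightarrow> f x = g x) \<Longrightarrow> a \<in> F X \<Longrightarrow>
          Fm X Y f a = Fm X Y g a"
    and map_id: "a \<in> F X \<Longrightarrow> Fm X X (\<lambda>x. x) a = a"
    and map_comp: "f \<in> X \<rightarrow> Y \<Longrightarrow> g \<in> Y \<rightarrow> Z \<Longrightarrow> a \<in> F X \<Longrightarrow>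
          Fm X Z (\<lambda>x. g (f x)) a = Fm Y Z g (Fm X Y f a)"

definition finite_coalgebra :: "('u set \<Rightarrow> 'f set) \<Rightarrow> 'u set \<Rightarrow> ('u \<Rightarrow> 'f) \<Rightarrow> bool" where
  "finite_coalgebra F X \<xi> \<longleftrightarrow> finite X \<and> \<xi> \<in> X \<rightarrow> F X"

text \<open>\<open>l X A a\<close> is the value of the component at \<open>X\<close>, applied to the predicate \<open>A\<close>, at \<open>a\<close>.\<close>

type_synonym ('u, 'f) lifting = "'u set \<Rightarrow> 'u set \<Rightarrow> 'f \<Rightarrow> real"

definition monotone_predicate_lifting ::
  "('u set \<Rightarrow> 'f set) \<Rightarrow> ('u set \<Rightarrow> 'u set \<Rightarrow> ('u \<Rightarrow> 'u) \<Rightarrow> 'f \<Rightarrow> 'f) \<Rightarrow> ('u, 'f) lifting \<Rightarrow> bool" where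
  "monotone_predicate_lifting F Fm l \<longleftrightarrow>
     (\<forall>X A a. A \<subseteq> X \<longrightarrow> a \<in> F X \<longrightarrow> l X A a \<in> {0..1}) \<and>
     (\<forall>X Y f A a. f \<in> X \<rightarrow> Y \<longrightarrow> A \<subseteq> Y \<longrightarrow> a \<in> F X \<longrightarrow>
        l Y A (Fm X Y f a) = l X (f -` A \<inter> X) a) \<and>
     (\<forall>X A B a. A \<subseteq> B \<longrightarrow> B \<subseteq> X \<longrightarrow> a \<in> F X \<longrightarrow> l X A a \<le> l X B a)"

text \<open>
  In the following, \<open>nm\<close> names states, \<open>CF X\<close> codes elements of \<open>F X\<close>, and \<open>CL\<close> codes liftings.
  An instance is a tuple \<open>(\<epsilon>, X, Y, a, b, S)\<close>.
\<close>

definition solver_instance ::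
  "('u set \<Rightarrow> 'f set) \<Rightarrow> ('u \<Rightarrow> data) \<Rightarrow> ('u set \<Rightarrow> 'f coding) \<Rightarrow>
   (rat \<times> 'u set \<times> 'u set \<times> 'f \<times> 'f \<times> ('u \<times> 'u) set) coding" where
  "solver_instance F nm CF d = (\<lambda>(\<epsilon>, X, Y, a, b, S).
     0 \<le> \<epsilon> \<and> finite X \<and> finite Y \<and> a \<in> F X \<and> b \<in> F Y \<and> S \<subseteq> X \<times> Y \<and>
     code_pair (code_by data_rat)
       (code_pair (code_set (code_by nm))
       (code_pair (code_set (code_by nm))
       (code_pair (CF X)
       (code_pair (CF Y)
         (code_set (code_pair (code_by nm) (code_by nm)))))))
       d (\<epsilon>, X, Y, a, b, S))"

definition solver_witness ::
  "('u, 'f) lifting set \<Rightarrow> rat \<times> 'u set \<times> 'u set \<times> 'f \<times> 'f \<times> ('u \<times> 'u) set \<Rightarrow>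
   'u set \<times> 'u set \<times> ('u, 'f) lifting \<Rightarrow> bool" where
  "solver_witness \<Lambda> = (\<lambda>(\<epsilon>, X, Y, a, b, S) (A, B, l).
     A \<subseteq> X \<and> B \<subseteq> Y \<and> l \<in> \<Lambda> \<and> l Y B b < l X A a - of_rat \<epsilon> \<and> A \<times> (Y - B) \<subseteq> S)"

text \<open>The answer \<open>Leaf\<close> means no, and \<open>Node Leaf e\<close> means yes, with witness coded by \<open>e\<close>.\<close>

definition solver_output ::
  "('u, 'f) lifting set \<Rightarrow> ('u \<Rightarrow> data) \<Rightarrow> ('u, 'f) lifting coding \<Rightarrow>
   rat \<times> 'u set \<times> 'u set \<times> 'f \<times> 'f \<times> ('u \<times> 'u) set \<Rightarrow> data \<Rightarrow> bool" where
  "solver_output \<Lambda> nm CL i d \<longleftrightarrow>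
     (if \<exists>w. solver_witness \<Lambda> i w
      then \<exists>w e. d = Node Leaf e \<and> solver_witness \<Lambda> i w \<and>
             code_pair (code_set (code_by nm)) (code_pair (code_set (code_by nm)) CL) e w
      else d = Leaf)"

definition poly_time_solvable ::
  "('u set \<Rightarrow> 'f set) \<Rightarrow> ('u, 'f) lifting set \<Rightarrow>
   ('u \<Rightarrow> data) \<Rightarrow> ('u set \<Rightarrow> 'f coding) \<Rightarrow> ('u, 'f) lifting coding \<Rightarrow> bool" where
  "poly_time_solvable F \<Lambda> nm CF CL \<longleftrightarrow>
     poly_time_computable (solver_instance F nm CF) (solver_output \<Lambda> nm CL)"

datatype 'u position = Spoiler 'u 'u | Duplicator "'u set" "'u set"

inductive codensity_move ::
  "('u, 'f) lifting set \<Rightarrow> 'u set \<Rightarrow> ('u \<Rightarrow> 'f) \<Rightarrow> 'u set \<Rightarrow> ('u \<Rightarrow> 'f) \<Rightarrow> real \<Rightarrow>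
   'u position \<Rightarrow> 'u position \<Rightarrow> bool"
  for \<Lambda> X \<xi> Y \<zeta> \<epsilon> where
  "x \<in> X \<Longrightarrow> y \<in> Y \<Longrightarrow> A \<subseteq> X \<Longrightarrow> B \<subseteq> Y \<Longrightarrow> l \<in> \<Lambda> \<Longrightarrow> l Y B (\<zeta> y) < l X A (\<xi> x) - \<epsilon> \<Longrightarrow>
     codensity_move \<Lambda> X \<xi> Y \<zeta> \<epsilon> (Spoiler x y) (Duplicator A B)"
| "A \<subseteq> X \<Longrightarrow> B \<subseteq> Y \<Longrightarrow> x \<in> A \<Longrightarrow> y \<in> Y \<Longrightarrow> y \<notin> B \<Longrightarrow>
     codensity_move \<Lambda> X \<xi> Y \<zeta> \<epsilon> (Duplicator A B) (Spoiler x y)"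

text \<open>
  A strategy of Spoiler is a partial function from histories (nonempty lists of positions, oldest
  first). In what follows, \<open>E\<close> is the move relation.
\<close>

type_synonym 'u strategy = "'u position list \<Rightarrow> 'u position option"

definition follows ::
  "('u position \<Rightarrow> 'u position \<Rightarrow> bool) \<Rightarrow> 'u strategy \<Rightarrow> 'u position list \<Rightarrow> bool" where
  "follows E \<sigma> h \<longleftrightarrow> h \<noteq> [] \<and>
     (\<forall>i. Suc i < length h \<longrightarrow> E (h ! i) (h ! Suc i) \<and>
        (\<forall>x y. h ! i = Spoiler x y \<longrightarrow> \<sigma> (take (Suc i) h) = Some (h ! Suc i)))"

text \<open>
  Spoiler wins every play from \<open>p\<close> that follows \<open>\<sigma>\<close>: whenever it is Spoiler's turn, \<open>\<sigma>\<close> yields a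
  legal move (in particular Spoiler is not stuck), and no play is infinite. So every maximal play
  ends in a position of Duplicator without moves.
\<close>

definition winning_strategy_from ::
  "('u position \<Rightarrow> 'u position \<Rightarrow> bool) \<Rightarrow> 'u strategy \<Rightarrow> 'u position \<Rightarrow> bool" where
  "winning_strategy_from E \<sigma> p \<longleftrightarrow>
     (\<forall>h x y. follows E \<sigma> h \<and> hd h = p \<and> last h = Spoiler x y \<longrightarrow>
        (\<exists>q. \<sigma> h = Some q \<and> E (Spoiler x y) q)) \<and>
     (\<nexists>f :: nat \<Rightarrow> 'u position. f 0 = p \<and> (\<forall>n. follows E \<sigma> (map f [0..<Suc n])))"

definition spoiler_winning_region ::
  "('u, 'f) lifting set \<Rightarrow> 'u set \<Rightarrow> ('u \<Rightarrow> 'f) \<Rightarrow> 'u set \<Rightarrow> ('u \<Rightarrow> 'f) \<Rightarrow> real \<Rightarrow> ('u \<times> 'u) set" where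
  "spoiler_winning_region \<Lambda> X \<xi> Y \<zeta> \<epsilon> =
     {(x, y) \<in> X \<times> Y. \<exists>\<sigma>. winning_strategy_from (codensity_move \<Lambda> X \<xi> Y \<zeta> \<epsilon>) \<sigma> (Spoiler x y)}"

definition history_free :: "('u \<times> 'u \<rightharpoonup> 'u set \<times> 'u set) \<Rightarrow> 'u strategy" where
  "history_free m h = (case last h of
     Spoiler x y \<Rightarrow> map_option (\<lambda>(A, B). Duplicator A B) (m (x, y))
   | Duplicator A B \<Rightarrow> None)"

definition history_free_winning_strategy ::
  "('u, 'f) lifting set \<Rightarrow> 'u set \<Rightarrow> ('u \<Rightarrow> 'f) \<Rightarrow> 'u set \<Rightarrow> ('u \<Rightarrow> 'f) \<Rightarrow> real \<Rightarrow>
   ('u \<times> 'u \<rightharpoonup> 'u set \<times> 'u set) \<Rightarrow> bool" where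
  "history_free_winning_strategy \<Lambda> X \<xi> Y \<zeta> \<epsilon> m \<longleftrightarrow>
     dom m = spoiler_winning_region \<Lambda> X \<xi> Y \<zeta> \<epsilon> \<and>
     (\<forall>(x, y) \<in> dom m.
        winning_strategy_from (codensity_move \<Lambda> X \<xi> Y \<zeta> \<epsilon>) (history_free m) (Spoiler x y))"

text \<open>Finite coalgebras and strategies are coded as finite functions, by their graphs.\<close>

definition game_instance ::
  "('u set \<Rightarrow> 'f set) \<Rightarrow> ('u \<Rightarrow> data) \<Rightarrow> ('u set \<Rightarrow> 'f coding) \<Rightarrow>
   (rat \<times> ('u set \<times> ('u \<Rightarrow> 'f)) \<times> ('u set \<times> ('u \<Rightarrow> 'f))) coding" where
  "game_instance F nm CF d = (\<lambda>(\<epsilon>, (X, \<xi>), (Y, \<zeta>)).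
     0 \<le> \<epsilon> \<and> finite_coalgebra F X \<xi> \<and> finite_coalgebra F Y \<zeta> \<and>
     code_pair (code_by data_rat)
       (code_pair (code_set (code_pair (code_by nm) (CF X)))
                  (code_set (code_pair (code_by nm) (CF Y))))
       d (\<epsilon>, (\<lambda>x. (x, \<xi> x)) ` X, (\<lambda>y. (y, \<zeta> y)) ` Y))"

definition winning_region_output ::
  "('u, 'f) lifting set \<Rightarrow> ('u \<Rightarrow> data) \<Rightarrow>
   rat \<times> ('u set \<times> ('u \<Rightarrow> 'f)) \<times> ('u set \<times> ('u \<Rightarrow> 'f)) \<Rightarrow> data \<Rightarrow> bool" where
  "winning_region_output \<Lambda> nm = (\<lambda>(\<epsilon>, (X, \<xi>), (Y, \<zeta>)) d.
     code_set (code_pair (code_by nm) (code_by nm)) d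
       (spoiler_winning_region \<Lambda> X \<xi> Y \<zeta> (of_rat \<epsilon>)))"

definition strategy_output ::
  "('u, 'f) lifting set \<Rightarrow> ('u \<Rightarrow> data) \<Rightarrow>
   rat \<times> ('u set \<times> ('u \<Rightarrow> 'f)) \<times> ('u set \<times> ('u \<Rightarrow> 'f)) \<Rightarrow> data \<Rightarrow> bool" where
  "strategy_output \<Lambda> nm = (\<lambda>(\<epsilon>, (X, \<xi>), (Y, \<zeta>)) d.
     \<exists>m. history_free_winning_strategy \<Lambda> X \<xi> Y \<zeta> (of_rat \<epsilon>) m \<and>
       code_set (code_pair (code_pair (code_by nm) (code_by nm))
                  (code_pair (code_set (code_by nm)) (code_set (code_by nm))))
         d (Map.graph m))"

end

theory Submission
  imports Defs
begin

text \<open>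
  Spoiler wins at a position iff he has a move all of whose answers are already known to be won, and
  with S the set of known wins this is precisely a query to the solver. Hence a program sweeps over
  the positions not yet won, queries the solver at each of them, and stops after a sweep without
  success; there are at most |X| |Y| + 1 sweeps. Recording the solver's witness when a position is
  won gives the strategy: it always leads to positions won earlier, so plays are finite. After the
  last sweep, Duplicator can stay outside the positions won, against any strategy.
\<close>

section \<open>Polynomially bounded functions\<close>

text \<open>The set S grows during a sweep, so a negative answer given early in a sweep may be
  outdated at its end. Only a sweep without success has put all its queries about the same S; its
  negative answers then say that S is closed, and no fixpoint theorem is needed. Iterating a
  polynomial-time subroutine is delicate, because feeding its answers back into its queries could
  compose its polynomial with itself again and again. Here only names of won positions return to a
  query, while the sets chosen by the solver are merely stored in the strategy. As no position is
  listed twice, all queries obey one fixed polynomial bound in the input size, and so do the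
  answers. The solver is an unknown program that expects a blank store and may overwrite its
  variables. So these are reset before each call, and the caller keeps its data above them. Codes of
  elements of F X are never built by the program, the coding being an arbitrary relation; they are
  copied from the input.\<close>

definition poly_bounded :: "(nat \<Rightarrow> nat) \<Rightarrow> bool" where
  "poly_bounded f \<longleftrightarrow> (\<exists>p :: nat poly. \<forall>n. f n \<le> poly p n)"

lemma poly_nat_mono: "m \<le> n \<Longrightarrow> poly p m \<le> poly p n" for p :: "nat poly"
  by (induction p) (auto intro: add_mono mult_mono)

lemma poly_bounded_const: "poly_bounded (\<lambda>_. k)"
  unfolding poly_bounded_def by (rule exI[of _ "[:k:]"]) simp

lemma poly_bounded_ident: "poly_bounded (\<lambda>n. n)"
  unfolding poly_bounded_def by (rule exI[of _ "[:0, 1:]"]) simp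

lemma poly_bounded_add:
  assumes "poly_bounded f" "poly_bounded g"
  shows "poly_bounded (\<lambda>n. f n + g n)"
proof -
  from assms obtain p q where "\<And>n. f n \<le> poly p n" "\<And>n. g n \<le> poly q n"
    unfolding poly_bounded_def by blast
  then have "\<forall>n. f n + g n \<le> poly (p + q) n" by (simp add: add_mono)
  then show ?thesis unfolding poly_bounded_def by blast
qed

lemma poly_bounded_mult:
  assumes "poly_bounded f" "poly_bounded g"
  shows "poly_bounded (\<lambda>n. f n * g n)"
proof -
  from assms obtain p q where "\<And>n. f n \<le> poly p n" "\<And>n. g n \<le> poly q n"
    unfolding poly_bounded_def by blast
  then have "\<forall>n. f n * g n \<le> poly (p * q) n" by (simp add: mult_mono)
  then show ?thesis unfolding poly_bounded_def by blast
qed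

lemma poly_bounded_Suc: "poly_bounded f \<Longrightarrow> poly_bounded (\<lambda>n. Suc (f n))"
  using poly_bounded_add[OF poly_bounded_const[of 1]] by simp

text \<open>Composition is needed because the solver's polynomial is evaluated at a bound on the
  size of a query, which is itself polynomial in the input size.\<close>

lemma poly_bounded_poly:
  assumes "poly_bounded f"
  shows "poly_bounded (\<lambda>n. poly q (f n))"
proof -
  from assms obtain p where "\<And>n. f n \<le> poly p n"
    unfolding poly_bounded_def by blast
  then have "\<forall>n. poly q (f n) \<le> poly (pcompose q p) n"
    by (simp add: poly_pcompose poly_nat_mono)
  then show ?thesis unfolding poly_bounded_def by blast
qed

lemmas poly_bounded_intros = poly_bounded_const poly_bounded_ident poly_bounded_add
  poly_bounded_mult poly_bounded_Suc poly_bounded_poly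

section \<open>Reasoning about WHILE programs\<close>

text \<open>Total correctness with a time budget. Asking for one run suffices, \<open>exec\<close>
  being deterministic, and since the budget is only an upper bound, all iterations of a loop can
  share one.\<close>

definition runs :: "com \<Rightarrow> store \<Rightarrow> nat \<Rightarrow> (store \<Rightarrow> bool) \<Rightarrow> bool" where
  "runs c s b Q \<longleftrightarrow> (\<exists>t s'. exec c s t s' \<and> t \<le> b \<and> Q s')"

lemma runs_weaken:
  "runs c s b Q \<Longrightarrow> (\<And>s'. Q s' \<Longrightarrow> Q' s') \<Longrightarrow> b \<le> b' \<Longrightarrow> runs c s b' Q'"
  unfolding runs_def by (meson le_trans)

lemma runs_Seq:
  assumes "runs c s b Q" "\<And>s'. Q s' \<Longrightarrow> runs c' s' b' Q'" "b + b' \<le> b''"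
  shows "runs (Seq c c') s b'' Q'"
proof -
  from assms(1) obtain t s1 where 1: "exec c s t s1" "t \<le> b" "Q s1"
    unfolding runs_def by blast
  from assms(2)[OF 1(3)] obtain t' s2 where 2: "exec c' s1 t' s2" "t' \<le> b'" "Q' s2"
    unfolding runs_def by blast
  have "exec (Seq c c') s (t + t') s2" using 1(1) 2(1) by (rule exec.Seq)
  moreover have "t + t' \<le> b''" using 1(2) 2(2) assms(3) by linarith
  ultimately show ?thesis using 2(3) unfolding runs_def by blast
qed

lemma runs_If:
  assumes "s x \<noteq> Leaf \<Longrightarrow> runs c s b Q" "s x = Leaf \<Longrightarrow> runs c' s b Q" "Suc b \<le> b'"
  shows "runs (If_Node x c c') s b' Q"
proof (cases "s x = Leaf")
  case True
  with assms(2) obtain t s' where "exec c' s t s'" "t \<le> b" "Q s'"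
    unfolding runs_def by blast
  with exec.If_False[of s x, OF True this(1)] assms(3) show ?thesis
    unfolding runs_def by (meson Suc_le_mono le_trans)
next
  case False
  with assms(1) obtain t s' where "exec c s t s'" "t \<le> b" "Q s'"
    unfolding runs_def by blast
  with exec.If_True[of s x, OF False this(1)] assms(3) show ?thesis
    unfolding runs_def by (meson Suc_le_mono le_trans)
qed

lemma runs_While_step:
  assumes "s x \<noteq> Leaf" "runs c s b Q" "\<And>s'. Q s' \<Longrightarrow> runs (While_Node x c) s' b' Q'"
    and "Suc (b + b') \<le> b''"
  shows "runs (While_Node x c) s b'' Q'"
proof -
  from assms(2) obtain t s1 where 1: "exec c s t s1" "t \<le> b" "Q s1"
    unfolding runs_def by blast
  from assms(3)[OF 1(3)] obtain t' s2 where 2: "exec (While_Node x c) s1 t' s2" "t' \<le> b'" "Q' s2"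
    unfolding runs_def by blast
  have "exec (While_Node x c) s (Suc (t + t')) s2"
    using assms(1) 1(1) 2(1) by (rule exec.While_True)
  moreover have "Suc (t + t') \<le> b''" using 1(2) 2(2) assms(4) by linarith
  ultimately show ?thesis using 2(3) unfolding runs_def by blast
qed

lemma runs_While_stop: "s x = Leaf \<Longrightarrow> 1 \<le> b \<Longrightarrow> Q s \<Longrightarrow> runs (While_Node x c) s b Q"
  unfolding runs_def using exec.While_False by blast

text \<open>The index is a variant: it drops by one in each iteration, and the premise excludes an
  iteration at 0. This suits the loop over sweeps, whose number is only bounded in advance. Each
  iteration pays 1 for its test, and the last 1 is the failing test.\<close>

lemma runs_While:
  assumes "\<And>n s. I n s \<Longrightarrow> s x \<noteq> Leaf \<Longrightarrow> \<exists>m. n = Suc m \<and> runs c s b (I m)"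
    and "I n s"
  shows "runs (While_Node x c) s (n * Suc b + 1) (\<lambda>s'. s' x = Leaf \<and> (\<exists>m. I m s'))"
  using assms(2)
proof (induction n arbitrary: s)
  case 0
  with assms(1)[of 0 s] have "s x = Leaf" by auto
  with 0 show ?case by (intro runs_While_stop) auto
next
  case (Suc n)
  show ?case
  proof (cases "s x = Leaf")
    case True
    with Suc.prems show ?thesis by (intro runs_While_stop) auto
  next
    case False
    with assms(1)[of "Suc n" s] Suc.prems have "runs c s b (I n)" by auto
    with False show ?thesis by (rule runs_While_step) (rule Suc.IH, auto)
  qed
qed

text \<open>Here the variant is the list of items still to be processed, so the loop ends exactly at
  \<open>[]\<close> and the invariant there is the result.\<close>

lemma runs_foreach:
  assumes "\<And>a as s. I (a # as) s \<Longrightarrow> s x \<noteq> Leaf"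
    and "\<And>a as s. I (a # as) s \<Longrightarrow> runs c s b (I as)"
    and "\<And>s. I [] s \<Longrightarrow> s x = Leaf"
    and "I as s"
  shows "runs (While_Node x c) s (length as * Suc b + 1) (I [])"
  using assms(4)
proof (induction as arbitrary: s)
  case Nil
  with assms(3) show ?case by (intro runs_While_stop) auto
next
  case (Cons a as)
  from assms(1,2)[OF Cons.prems] show ?case
    by (rule runs_While_step) (rule Cons.IH, auto)
qed

text \<open>
  On programs without tests and loops, the symbolic evaluators \<open>effect\<close> and \<open>cost\<close> let the
  simplifier compute the final store and the running time; elsewhere their values are junk.
\<close>

primrec straight :: "com \<Rightarrow> bool" where
  "straight (Set_Leaf x) = True"
| "straight (Copy x y) = True"
| "straight (Make_Node x y z) = True"
| "straight (Take_Left x y) = True"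
| "straight (Take_Right x y) = True"
| "straight (Seq c c') = (straight c \<and> straight c')"
| "straight (If_Node x c c') = False"
| "straight (While_Node x c) = False"

primrec effect :: "com \<Rightarrow> store \<Rightarrow> store" where
  "effect (Set_Leaf x) s = s(x := Leaf)"
| "effect (Copy x y) s = s(x := s y)"
| "effect (Make_Node x y z) s = s(x := Node (s y) (s z))"
| "effect (Take_Left x y) s = s(x := left (s y))"
| "effect (Take_Right x y) s = s(x := right (s y))"
| "effect (Seq c c') s = effect c' (effect c s)"
| "effect (If_Node x c c') s = s"
| "effect (While_Node x c) s = s"

primrec cost :: "com \<Rightarrow> store \<Rightarrow> nat" where
  "cost (Set_Leaf x) s = 2"
| "cost (Copy x y) s = Suc (data_size (s y))"
| "cost (Make_Node x y z) s = Suc (Suc (data_size (s y) + data_size (s z)))"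
| "cost (Take_Left x y) s = Suc (data_size (left (s y)))"
| "cost (Take_Right x y) s = Suc (data_size (right (s y)))"
| "cost (Seq c c') s = cost c s + cost c' (effect c s)"
| "cost (If_Node x c c') s = 0"
| "cost (While_Node x c) s = 0"

lemma exec_straight: "straight c \<Longrightarrow> exec c s (cost c s) (effect c s)"
proof (induction c arbitrary: s)
  case (Set_Leaf x)
  then show ?case using exec.Set_Leaf[of x s] by (simp add: numeral_2_eq_2 del: fun_upd_apply)
next
  case (Make_Node x y z)
  then show ?case using exec.Make_Node[of x y z s] by (simp del: fun_upd_apply)
qed (auto intro: exec.intros)

lemma runs_straight: "straight c \<Longrightarrow> cost c s \<le> b \<Longrightarrow> Q (effect c s) \<Longrightarrow> runs c s b Q"
  unfolding runs_def using exec_straight by blast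

abbreviation (input) then_do :: "com \<Rightarrow> com \<Rightarrow> com" (infixr ";;" 60) where
  "c ;; c' \<equiv> Seq c c'"

primrec max_var :: "com \<Rightarrow> var" where
  "max_var (Set_Leaf x) = x"
| "max_var (Copy x y) = max x y"
| "max_var (Make_Node x y z) = max x (max y z)"
| "max_var (Take_Left x y) = max x y"
| "max_var (Take_Right x y) = max x y"
| "max_var (Seq c c') = max (max_var c) (max_var c')"
| "max_var (If_Node x c c') = max x (max (max_var c) (max_var c'))"
| "max_var (While_Node x c) = max x (max_var c)"

text \<open>A run neither reads nor writes variables beyond \<open>max_var c\<close>. Hence a run
  known only from a blank store can be replayed in any store that agrees with it up to
  \<open>k\<close>, and the caller's data above \<open>k\<close> survive.\<close>

lemma exec_frame:
  "exec c s t s' \<Longrightarrow> max_var c \<le> k \<Longrightarrow> (\<And>v. v \<le> k \<Longrightarrow> u v = s v) \<Longrightarrow>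
     \<exists>u'. exec c u t u' \<and> (\<forall>v\<le>k. u' v = s' v) \<and> (\<forall>v>k. u' v = u v)"
proof (induction arbitrary: u rule: exec.induct)
  case (Set_Leaf x s)
  then show ?case using exec.Set_Leaf[of x u] by fastforce
next
  case (Copy x y s)
  then show ?case using exec.Copy[of x y u] by fastforce
next
  case (Make_Node x y z s)
  then show ?case using exec.Make_Node[of x y z u] by fastforce
next
  case (Take_Left x y s)
  then show ?case using exec.Take_Left[of x y u] by fastforce
next
  case (Take_Right x y s)
  then show ?case using exec.Take_Right[of x y u] by fastforce
next
  case (Seq c1 s t1 s1 c2 t2 s2)
  from Seq.prems have le: "max_var c1 \<le> k" "max_var c2 \<le> k" by auto
  from Seq.IH(1)[OF le(1) Seq.prems(2)] obtain u1 where
    u1: "exec c1 u t1 u1" "\<And>v. v \<le> k \<Longrightarrow> u1 v = s1 v" "\<forall>v>k. u1 v = u v" by blast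
  from Seq.IH(2)[OF le(2) u1(2)] obtain u2 where
    u2: "exec c2 u1 t2 u2" "\<forall>v\<le>k. u2 v = s2 v" "\<forall>v>k. u2 v = u1 v" by blast
  from exec.Seq[OF u1(1) u2(1)] u1(3) u2(2,3) show ?case by auto
next
  case (If_True s x c1 t s' c2)
  from If_True.prems have le: "max_var c1 \<le> k" "x \<le> k" by auto
  from If_True.IH[OF le(1) If_True.prems(2)] obtain u1 where
    u1: "exec c1 u t u1" "\<forall>v\<le>k. u1 v = s' v" "\<forall>v>k. u1 v = u v" by blast
  have "u x \<noteq> Leaf" using If_True.hyps(1) If_True.prems(2)[OF le(2)] by simp
  from exec.If_True[of u x, OF this u1(1)] u1(2,3) show ?case by blast
next
  case (If_False s x c2 t s' c1)
  from If_False.prems have le: "max_var c2 \<le> k" "x \<le> k" by auto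
  from If_False.IH[OF le(1) If_False.prems(2)] obtain u1 where
    u1: "exec c2 u t u1" "\<forall>v\<le>k. u1 v = s' v" "\<forall>v>k. u1 v = u v" by blast
  have "u x = Leaf" using If_False.hyps(1) If_False.prems(2)[OF le(2)] by simp
  from exec.If_False[of u x, OF this u1(1)] u1(2,3) show ?case by blast
next
  case (While_True s x c t1 s1 t2 s2)
  from While_True.prems have le: "max_var c \<le> k" "x \<le> k" "max_var (While_Node x c) \<le> k" by auto
  from While_True.IH(1)[OF le(1) While_True.prems(2)] obtain u1 where
    u1: "exec c u t1 u1" "\<And>v. v \<le> k \<Longrightarrow> u1 v = s1 v" "\<forall>v>k. u1 v = u v" by blast
  from While_True.IH(2)[OF le(3) u1(2)] obtain u2 where
    u2: "exec (While_Node x c) u1 t2 u2" "\<forall>v\<le>k. u2 v = s2 v" "\<forall>v>k. u2 v = u1 v" by blast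
  have "u x \<noteq> Leaf" using While_True.hyps(1) While_True.prems(2)[OF le(2)] by simp
  from exec.While_True[of u x, OF this u1(1) u2(1)] u1(3) u2(2,3) show ?case by auto
next
  case (While_False s x c)
  then have "u x = Leaf" by simp
  from exec.While_False[of u x, OF this] While_False.prems show ?case by auto
qed

text \<open>Every assignment is charged the size of the tree that it stores. This turns the time
  bound of the solver into a bound on its answer.\<close>

lemma exec_size: "exec c s t s' \<Longrightarrow> data_size (s' v) \<le> data_size (s v) + t"
proof (induction rule: exec.induct)
  case (While_True s x c t1 s1 t2 s2)
  then show ?case by linarith
qed auto

text \<open>Programs cannot address variables by a computed index, so the reset is a fixed sequence
  of assignments, generated outside the language. It removes what the previous call of the solver
  left behind.\<close>

primrec clear_upto :: "nat \<Rightarrow> com" where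
  "clear_upto 0 = Set_Leaf 0"
| "clear_upto (Suc k) = clear_upto k ;; Set_Leaf (Suc k)"

lemma straight_clear_upto: "straight (clear_upto k)"
  by (induction k) auto

lemma effect_clear_upto: "effect (clear_upto k) s = (\<lambda>v. if v \<le> k then Leaf else s v)"
  by (induction k) (auto simp: le_Suc_eq)

lemma cost_clear_upto: "cost (clear_upto k) s = 2 * Suc k"
  by (induction k) auto

section \<open>Codes\<close>

lemma data_size_data_list: "data_size (data_list ds) = Suc (\<Sum>d\<leftarrow>ds. Suc (data_size d))"
  by (induction ds) auto

lemma data_size_data_list_le:
  "(\<And>d. d \<in> set ds \<Longrightarrow> data_size d \<le> m) \<Longrightarrow> data_size (data_list ds) \<le> Suc (length ds * Suc m)"
proof (induction ds)
  case (Cons d ds)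
  from Cons.prems[of d] Cons.IH Cons.prems show ?case by fastforce
qed auto

lemma length_le_data_size_data_list: "length ds \<le> data_size (data_list ds)"
  by (induction ds) auto

lemma data_size_le_data_list: "d \<in> set ds \<Longrightarrow> data_size d \<le> data_size (data_list ds)"
  by (induction ds) auto

lemma data_size_data_list_rev: "data_size (data_list (rev ds)) = data_size (data_list ds)"
  by (simp add: data_size_data_list rev_map[symmetric] sum_list_rev)

text \<open>An element may have many codes, and the list selects one for each place. Without
  repetitions a place is determined by its element, so the selection becomes a function of the
  element.\<close>

lemma list_all2_distinct_map:
  assumes "list_all2 R ds as" "distinct as"
  shows "\<exists>g. ds = map g as \<and> (\<forall>a\<in>set as. R (g a) a)"
  using assms
proof (induction rule: list_all2_induct)
  case (Cons d ds a as)
  then obtain g where "ds = map g as" "\<forall>a\<in>set as. R (g a) a" by auto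
  with Cons show ?case by (intro exI[of _ "g(a := d)"]) auto
qed auto

lemma code_setI: "list_all2 R ds as \<Longrightarrow> distinct as \<Longrightarrow> code_set R (data_list ds) (set as)"
  unfolding code_set_def by blast

text \<open>Fixes the codes \<open>g x\<close> of the values \<open>f x\<close> that this particular
  input uses; these are the ones that later go verbatim into the queries.\<close>

lemma code_set_graph:
  assumes "code_set (code_pair (code_by nm) R) d ((\<lambda>x. (x, f x)) ` X)"
  obtains xs g where "d = data_list (map (\<lambda>x. Node (nm x) (g x)) xs)"
    "distinct xs" "set xs = X" "\<And>x. x \<in> X \<Longrightarrow> R (g x) (f x)"
proof -
  from assms obtain ds as where ds: "d = data_list ds"
    "list_all2 (code_pair (code_by nm) R) ds as" "distinct as" "set as = (\<lambda>x. (x, f x)) ` X"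
    unfolding code_set_def by blast
  define xs where "xs = map fst as"
  have as: "as = map (\<lambda>x. (x, f x)) xs"
    unfolding xs_def map_map using ds(4) by (intro map_idI[symmetric]) auto
  have X: "set xs = X" using ds(4) by (force simp: xs_def)
  have dist: "distinct xs" using ds(3) as by (simp add: distinct_map)
  from list_all2_distinct_map[OF ds(2,3)] obtain h where
    h: "ds = map h as" "\<And>a. a \<in> set as \<Longrightarrow> code_pair (code_by nm) R (h a) a" by blast
  define g where "g x = right (h (x, f x))" for x
  have g: "h (x, f x) = Node (nm x) (g x) \<and> R (g x) (f x)" if "x \<in> X" for x
    using h(2)[of "(x, f x)"] that X as by (auto simp: code_pair_def code_by_def g_def)
  have "d = data_list (map (\<lambda>x. Node (nm x) (g x)) xs)"
    unfolding ds(1) h(1) as map_map using X g by (auto intro!: arg_cong[where f = data_list])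
  from that[OF this dist X] g show ?thesis by blast
qed

section \<open>Winning the codensity game\<close>

context
  fixes \<Lambda> :: "('u, 'f) lifting set" and X Y :: "'u set" and \<xi> \<zeta> :: "'u \<Rightarrow> 'f" and \<epsilon> :: real
begin

abbreviation (input) "E \<equiv> codensity_move \<Lambda> X \<xi> Y \<zeta> \<epsilon>"

text \<open>The most recently won position comes first.\<close>

primrec justified :: "(('u \<times> 'u) \<times> ('u set \<times> 'u set)) list \<Rightarrow> bool" where
  "justified [] = True"
| "justified (e # ml) \<longleftrightarrow> justified ml \<and>
     (case e of ((x, y), (A, B)) \<Rightarrow>
        E (Spoiler x y) (Duplicator A B) \<and> A \<times> (Y - B) \<subseteq> fst ` set ml)"

lemma justified_in:
  "justified ml \<Longrightarrow> ((x, y), (A, B)) \<in> set ml \<Longrightarrow>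
     E (Spoiler x y) (Duplicator A B) \<and> A \<times> (Y - B) \<subseteq> fst ` set ml"
  by (induction ml) auto

text \<open>Descent along the list: from the position in its head, Spoiler's move and any answer of
  Duplicator lead into the tail within two steps. The strategy \<open>m\<close> is kept apart from
  \<open>l\<close>, so that the induction can shrink the list while the strategy stays
  fixed.\<close>

lemma infinite_play_avoids_justified:
  assumes "justified l" "\<And>e. e \<in> set l \<Longrightarrow> m (fst e) = Some (snd e)"
    and "\<And>i. E (f i) (f (Suc i))"
    and "\<And>i x y. f i = Spoiler x y \<Longrightarrow>
           map_option (\<lambda>(A, B). Duplicator A B) (m (x, y)) = Some (f (Suc i))"
    and "f i = Spoiler x y"
  shows "(x, y) \<notin> fst ` set l"
  using assms(1,2,5)
proof (induction l arbitrary: i x y)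
  case (Cons e l)
  obtain x0 y0 A B where e: "e = ((x0, y0), (A, B))" by (metis prod.exhaust)
  have IH: "(x, y) \<notin> fst ` set l" if "f i = Spoiler x y" for i x y
    using Cons.IH[OF _ _ that] Cons.prems(1,2) by simp
  show ?case
  proof
    assume "(x, y) \<in> fst ` set (e # l)"
    with IH[OF Cons.prems(3)] e have "x = x0" "y = y0" by auto
    with Cons.prems(2)[of e] e have "m (x, y) = Some (A, B)" by simp
    with assms(4)[OF Cons.prems(3)] have D: "f (Suc i) = Duplicator A B" by simp
    from assms(3)[of "Suc i"] D obtain x' y' where
      *: "f (Suc (Suc i)) = Spoiler x' y'" "x' \<in> A" "y' \<in> Y - B"
      by (auto elim: codensity_move.cases)
    from Cons.prems(1) e have "A \<times> (Y - B) \<subseteq> fst ` set l" by simp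
    with * have "(x', y') \<in> fst ` set l" by blast
    with IH[OF *(1)] show False by blast
  qed
qed auto

lemma justified_winning:
  assumes "justified ml" "distinct (map fst ml)" "(x, y) \<in> fst ` set ml"
  shows "winning_strategy_from E (history_free (map_of ml)) (Spoiler x y)"
  unfolding winning_strategy_from_def
proof (intro conjI allI impI)
  let ?\<sigma> = "history_free (map_of ml)"
  \<comment> \<open>Invariant of the finite plays: all answers to a recorded pair (A, B) are
    recorded positions, so \<open>map_of ml\<close> is defined whenever it is Spoiler's
    turn.\<close>
  define good where "good q = (case q of Spoiler x y \<Rightarrow> (x, y) \<in> fst ` set ml
      | Duplicator A B \<Rightarrow> A \<times> (Y - B) \<subseteq> fst ` set ml)" for q
  have m: "map_of ml (fst e) = Some (snd e)" if "e \<in> set ml" for e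
    using that assms(2) by simp
  have move: "\<exists>A B. map_of ml (x, y) = Some (A, B) \<and> E (Spoiler x y) (Duplicator A B) \<and>
      good (Duplicator A B)" if xy: "(x, y) \<in> fst ` set ml" for x y
  proof -
    from xy obtain A B where "((x, y), (A, B)) \<in> set ml" by auto
    with m[OF this] justified_in[OF assms(1) this] show ?thesis by (auto simp: good_def)
  qed
  fix h x' y'
  assume h: "follows E ?\<sigma> h \<and> hd h = Spoiler x y \<and> last h = Spoiler x' y'"
  have "good (h ! i)" if "i < length h" for i
    using that
  proof (induction i)
    case 0
    then show ?case using h assms(3) by (simp add: hd_conv_nth good_def)
  next
    case (Suc i)
    then have g: "good (h ! i)" by simp
    from h Suc.prems have st: "E (h ! i) (h ! Suc i)"
      "\<And>x y. h ! i = Spoiler x y \<Longrightarrow> ?\<sigma> (take (Suc i) h) = Some (h ! Suc i)"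
      unfolding follows_def by auto
    have l: "last (take (Suc i) h) = h ! i"
      using Suc.prems by (simp add: take_Suc_conv_app_nth)
    show ?case
    proof (cases "h ! i")
      case (Spoiler a b)
      with g have "(a, b) \<in> fst ` set ml" by (simp add: good_def)
      from move[OF this] obtain A B
        where "map_of ml (a, b) = Some (A, B)" "good (Duplicator A B)" by blast
      with st(2)[OF Spoiler] l Spoiler show ?thesis by (auto simp: history_free_def)
    next
      case (Duplicator A B)
      with st(1) obtain a b where "h ! Suc i = Spoiler a b" "a \<in> A" "b \<in> Y - B"
        by (auto elim: codensity_move.cases)
      with g Duplicator show ?thesis by (auto simp: good_def)
    qed
  qed
  moreover have ne: "h \<noteq> []" using h by (simp add: follows_def)
  ultimately have "good (last h)" by (simp add: last_conv_nth)
  then have "(x', y') \<in> fst ` set ml" using h by (simp add: good_def)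
  from move[OF this] h show "\<exists>q. ?\<sigma> h = Some q \<and> E (Spoiler x' y') q"
    by (auto simp: history_free_def)
next
  let ?\<sigma> = "history_free (map_of ml)"
  show "\<nexists>f. f 0 = Spoiler x y \<and> (\<forall>n. follows E ?\<sigma> (map f [0..<Suc n]))"
  proof
    assume "\<exists>f. f 0 = Spoiler x y \<and> (\<forall>n. follows E ?\<sigma> (map f [0..<Suc n]))"
    then obtain f where f: "f 0 = Spoiler x y" "\<And>n. follows E ?\<sigma> (map f [0..<Suc n])"
      by blast
    \<comment> \<open>The prefix ending in \<open>f (Suc i)\<close> is the shortest one that
      constrains the move made at \<open>f i\<close>.\<close>
    have E: "E (f i) (f (Suc i))" and
      \<sigma>: "f i = Spoiler x y \<Longrightarrow> ?\<sigma> (map f [0..<Suc i]) = Some (f (Suc i))" for i x y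
      using f(2)[of "Suc i"] unfolding follows_def
      by (auto simp: nth_append take_map dest!: spec[of _ i] simp del: upt_Suc)
    have "map_option (\<lambda>(A, B). Duplicator A B) (map_of ml (x, y)) = Some (f (Suc i))"
      if "f i = Spoiler x y" for i x y
      using \<sigma>[OF that] that by (simp add: history_free_def)
    from infinite_play_avoids_justified[of ml "map_of ml" f, OF assms(1) _ E this f(1)] assms(2,3)
    show False by simp
  qed
qed

text \<open>Closedness makes the complement of \<open>W\<close> a trap: whatever Spoiler plays
  there, some answer stays outside \<open>W\<close>. A winning strategy would always supply a move,
  and the trap always an answer, which yields an infinite play.\<close>

lemma not_winning_outside_closed:
  assumes closed: "\<And>x y A B. (x, y) \<in> X \<times> Y - W \<Longrightarrow> E (Spoiler x y) (Duplicator A B) \<Longrightarrow>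
      \<not> A \<times> (Y - B) \<subseteq> W"
    and xy: "(x, y) \<in> X \<times> Y - W"
  shows "\<not> winning_strategy_from E \<sigma> (Spoiler x y)"
proof
  assume win: "winning_strategy_from E \<sigma> (Spoiler x y)"
  define good where "good h \<longleftrightarrow> follows E \<sigma> h \<and> hd h = Spoiler x y \<and>
     (case last h of Spoiler a b \<Rightarrow> (a, b) \<in> X \<times> Y - W
      | Duplicator A B \<Rightarrow> A \<subseteq> X \<and> B \<subseteq> Y \<and> \<not> A \<times> (Y - B) \<subseteq> W)" for h
  have ext: "\<exists>q. good (h @ [q])" if h: "good h" for h
  proof -
    from h have fo: "follows E \<sigma> h" "hd h = Spoiler x y" "h \<noteq> []"
      by (auto simp: good_def follows_def)
    have fo': "follows E \<sigma> (h @ [q])"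
      if "E (last h) q" "\<And>a b. last h = Spoiler a b \<Longrightarrow> \<sigma> h = Some q" for q
      unfolding follows_def
    proof (intro conjI allI impI)
      fix i assume i: "Suc i < length (h @ [q])"
      consider "Suc i < length h" | "Suc i = length h" using i by fastforce
      then show "E ((h @ [q]) ! i) ((h @ [q]) ! Suc i)"
      proof cases
        case 1
        then show ?thesis using fo(1) by (auto simp: follows_def nth_append)
      next
        case 2
        then have "i = length h - 1" by simp
        with 2 that(1) fo(3) show ?thesis by (simp add: nth_append last_conv_nth)
      qed
      fix a b assume ab: "(h @ [q]) ! i = Spoiler a b"
      consider "Suc i < length h" | "Suc i = length h" using i by fastforce
      then show "\<sigma> (take (Suc i) (h @ [q])) = Some ((h @ [q]) ! Suc i)"
      proof cases
        case 1
        then show ?thesis using fo(1) ab by (auto simp: follows_def nth_append)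
      next
        case 2
        then have "i = length h - 1" by simp
        with 2 that(2) fo(3) ab show ?thesis by (simp add: nth_append last_conv_nth)
      qed
    qed simp
    show ?thesis
    proof (cases "last h")
      case (Spoiler a b)
      with win fo obtain q where q: "\<sigma> h = Some q" "E (Spoiler a b) q"
        unfolding winning_strategy_from_def by blast
      from q(2) obtain A B where A: "q = Duplicator A B" "A \<subseteq> X" "B \<subseteq> Y"
        by (auto elim: codensity_move.cases)
      from h Spoiler have "(a, b) \<in> X \<times> Y - W" by (simp add: good_def)
      from closed[OF this] q(2) A fo'[of q] fo q Spoiler have "good (h @ [q])"
        by (auto simp: good_def)
      then show ?thesis ..
    next
      case (Duplicator A B)
      with h have A: "A \<subseteq> X" "B \<subseteq> Y" "\<not> A \<times> (Y - B) \<subseteq> W" by (auto simp: good_def)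
      then obtain a b where ab: "a \<in> A" "b \<in> Y" "b \<notin> B" "(a, b) \<notin> W" by blast
      with A have "E (last h) (Spoiler a b)"
        unfolding Duplicator by (intro codensity_move.intros)
      with fo'[of "Spoiler a b"] fo A ab Duplicator have "good (h @ [Spoiler a b])"
        by (auto simp: good_def)
      then show ?thesis ..
    qed
  qed
  \<comment> \<open>The strategy may consult the whole history, so the recursion runs over histories
    and chooses one extension at a time.\<close>
  define H where "H = rec_nat [Spoiler x y] (\<lambda>_ h. h @ [SOME q. good (h @ [q])])"
  have H0: "H 0 = [Spoiler x y]" and HS: "H (Suc n) = H n @ [SOME q. good (H n @ [q])]" for n
    by (simp_all add: H_def)
  have good: "good (H n)" for n
  proof (induction n)
    case 0
    then show ?case using xy by (simp add: H0 good_def follows_def)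
  next
    case (Suc n)
    from someI_ex[OF ext[OF Suc]] show ?case by (simp add: HS)
  qed
  \<comment> \<open>Each history extends the previous one by a single position, so the last
    positions form the play whose prefixes are the \<open>H n\<close>.\<close>
  define f where "f n = last (H n)" for n
  have "map f [0..<Suc n] = H n" for n
    by (induction n) (simp_all add: f_def H0 HS)
  then have "follows E \<sigma> (map f [0..<Suc n])" for n
    using good by (simp only:) (simp add: good_def)
  moreover have "f 0 = Spoiler x y" by (simp add: f_def H0)
  ultimately show False using win unfolding winning_strategy_from_def by blast
qed

text \<open>Justification gives soundness of the recorded wins and closedness their completeness.
  Distinct positions make \<open>map_of ml\<close> return every recorded move.\<close>

lemma justified_closed_winning_region:
  assumes "justified ml" "distinct (map fst ml)" "fst ` set ml \<subseteq> X \<times> Y"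
    and "\<And>x y A B. (x, y) \<in> X \<times> Y - fst ` set ml \<Longrightarrow> E (Spoiler x y) (Duplicator A B) \<Longrightarrow>
      \<not> A \<times> (Y - B) \<subseteq> fst ` set ml"
  shows "spoiler_winning_region \<Lambda> X \<xi> Y \<zeta> \<epsilon> = fst ` set ml"
    and "history_free_winning_strategy \<Lambda> X \<xi> Y \<zeta> \<epsilon> (map_of ml)"
proof -
  show region: "spoiler_winning_region \<Lambda> X \<xi> Y \<zeta> \<epsilon> = fst ` set ml"
    unfolding spoiler_winning_region_def
    using assms(3) justified_winning[OF assms(1,2)] not_winning_outside_closed[OF assms(4)]
    by fast
  show "history_free_winning_strategy \<Lambda> X \<xi> Y \<zeta> \<epsilon> (map_of ml)"
    unfolding history_free_winning_strategy_def region
    using justified_winning[OF assms(1,2)]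
    by (simp add: dom_map_of_conv_image_fst split_beta del: split_paired_All)
qed

end


section \<open>The program\<close>

text \<open>
  The variables up to \<open>k\<close> are left to the given solver. Keeping the list of the positions that have
  not been won spares an equality test on trees, which the language lacks.
\<close>

abbreviation (input) "eps_var k \<equiv> k + (2 :: nat)"
abbreviation (input) "graph1_var k \<equiv> k + (3 :: nat)"
abbreviation (input) "graph2_var k \<equiv> k + (4 :: nat)"
abbreviation (input) "names1_var k \<equiv> k + (5 :: nat)"
abbreviation (input) "names2_var k \<equiv> k + (6 :: nat)"
abbreviation (input) "todo_var k \<equiv> k + (7 :: nat)"
abbreviation (input) "rest_var k \<equiv> k + (8 :: nat)"
abbreviation (input) "won_var k \<equiv> k + (9 :: nat)"
abbreviation (input) "strat_var k \<equiv> k + (10 :: nat)"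
abbreviation (input) "flag_var k \<equiv> k + (11 :: nat)"
abbreviation (input) "p_var k \<equiv> k + (12 :: nat)"
abbreviation (input) "a_var k \<equiv> k + (13 :: nat)"
abbreviation (input) "b_var k \<equiv> k + (14 :: nat)"
abbreviation (input) "t_var k \<equiv> k + (15 :: nat)"
abbreviation (input) "u_var k \<equiv> k + (16 :: nat)"
abbreviation (input) "inst_var k \<equiv> k + (17 :: nat)"

text \<open>The last instruction stores a proper node in the flag, which forces the first
  sweep.\<close>

definition unpack :: "nat \<Rightarrow> com" where
  "unpack k =
     Take_Left (eps_var k) 0 ;; Take_Right (t_var k) 0 ;;
     Take_Left (graph1_var k) (t_var k) ;; Take_Right (graph2_var k) (t_var k) ;;
     Set_Leaf (names1_var k) ;; Set_Leaf (names2_var k) ;; Set_Leaf (rest_var k) ;;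
     Set_Leaf (won_var k) ;; Set_Leaf (strat_var k) ;;
     Make_Node (flag_var k) (won_var k) (won_var k)"

text \<open>The solver wants the carriers, but the input codes only the graphs of the coalgebras.
  Consing reverses the order, which is harmless because any enumeration codes the set.\<close>

definition collect_names :: "var \<Rightarrow> var \<Rightarrow> var \<Rightarrow> com" where
  "collect_names t p D = While_Node t
     (Take_Left p t ;; Take_Left p p ;; Make_Node D p D ;; Take_Right t t)"

text \<open>A pair keeps both complete graph entries, so the codes of the transitions travel with
  the position and need not be looked up. The pairs go to \<open>rest_var\<close> because a sweep
  begins by moving that list to \<open>todo_var\<close>.\<close>

definition pair_up :: "nat \<Rightarrow> com" where
  "pair_up k = While_Node (t_var k)
     (Take_Left (p_var k) (t_var k) ;; Copy (u_var k) (graph2_var k) ;;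
      While_Node (u_var k)
        (Take_Left (a_var k) (u_var k) ;; Make_Node (a_var k) (p_var k) (a_var k) ;;
         Make_Node (rest_var k) (a_var k) (rest_var k) ;; Take_Right (u_var k) (u_var k)) ;;
      Take_Right (t_var k) (t_var k))"

definition initialize :: "nat \<Rightarrow> com" where
  "initialize k =
     unpack k ;;
     Copy (t_var k) (graph1_var k) ;; collect_names (t_var k) (p_var k) (names1_var k) ;;
     Copy (t_var k) (graph2_var k) ;; collect_names (t_var k) (p_var k) (names2_var k) ;;
     Copy (t_var k) (graph1_var k) ;; pair_up k"

text \<open>The nested tuple is built from its innermost component outwards. The full entry stays in
  \<open>p_var\<close> in case it must be put back, and the names stay in \<open>a_var\<close> and
  \<open>b_var\<close> in case the position is won.\<close>

definition prepare_instance :: "nat \<Rightarrow> com" where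
  "prepare_instance k =
     Take_Left (p_var k) (todo_var k) ;; Take_Right (todo_var k) (todo_var k) ;;
     Take_Left (a_var k) (p_var k) ;; Take_Right (b_var k) (p_var k) ;;
     Take_Right (t_var k) (a_var k) ;; Take_Right (u_var k) (b_var k) ;;
     Take_Left (a_var k) (a_var k) ;; Take_Left (b_var k) (b_var k) ;;
     Make_Node (inst_var k) (u_var k) (won_var k) ;;
     Make_Node (inst_var k) (t_var k) (inst_var k) ;;
     Make_Node (inst_var k) (names2_var k) (inst_var k) ;;
     Make_Node (inst_var k) (names1_var k) (inst_var k) ;;
     Make_Node (inst_var k) (eps_var k) (inst_var k)"

definition call :: "nat \<Rightarrow> com \<Rightarrow> var \<Rightarrow> com" where
  "call k c v = (clear_upto k ;; Copy 0 v) ;; c"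

text \<open>A positive answer is a proper node, so copying it raises the flag. The lifting in the
  answer is dropped: a move of Spoiler consists of the two sets only.\<close>

definition record_win :: "nat \<Rightarrow> com" where
  "record_win k =
     Copy (flag_var k) 0 ;; Take_Right (t_var k) 0 ;; Take_Left (u_var k) (t_var k) ;;
     Take_Right (t_var k) (t_var k) ;; Take_Left (t_var k) (t_var k) ;;
     Make_Node (t_var k) (u_var k) (t_var k) ;;
     Make_Node (u_var k) (a_var k) (b_var k) ;;
     Make_Node (won_var k) (u_var k) (won_var k) ;;
     Make_Node (u_var k) (u_var k) (t_var k) ;;
     Make_Node (strat_var k) (u_var k) (strat_var k)"

definition try_position :: "nat \<Rightarrow> com \<Rightarrow> com" where
  "try_position k c =
     prepare_instance k ;; call k c (inst_var k) ;;
     If_Node 0 (record_win k) (Make_Node (rest_var k) (p_var k) (rest_var k))"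

definition sweep :: "nat \<Rightarrow> com \<Rightarrow> com" where
  "sweep k c =
     (Copy (todo_var k) (rest_var k) ;; Set_Leaf (rest_var k) ;; Set_Leaf (flag_var k)) ;;
     While_Node (todo_var k) (try_position k c)"

definition solve_game :: "nat \<Rightarrow> com \<Rightarrow> com" where
  "solve_game k c = initialize k ;; While_Node (flag_var k) (sweep k c)"

section \<open>Bounds on sizes and running times in terms of the input size\<close>

definition pairs_size :: "nat \<Rightarrow> nat" where
  "pairs_size n = Suc (n * n * (2 * n + 2))"

text \<open>A query consists of five pair nodes, five trees of size at most n (the rational, two
  lists of names, two transition codes) and the list of won positions.\<close>

definition instance_size :: "nat \<Rightarrow> nat" where
  "instance_size n = 5 + 5 * n + pairs_size n"

text \<open>The form comes from \<open>exec_size\<close>: size of the query plus running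
  time.\<close>

definition answer_size :: "nat poly \<Rightarrow> nat \<Rightarrow> nat" where
  "answer_size q n = instance_size n + poly q (instance_size n)"

definition strat_size :: "nat poly \<Rightarrow> nat \<Rightarrow> nat" where
  "strat_size q n = Suc (n * n * (2 * n + 3 + answer_size q n))"

text \<open>The factors 13 and 10 count the instructions of \<open>prepare_instance\<close> and
  \<open>record_win\<close>. The middle summand is the call, with 2 for each of the k + 1
  resets.\<close>

definition try_time :: "nat \<Rightarrow> nat poly \<Rightarrow> nat \<Rightarrow> nat" where
  "try_time k q n = 13 * Suc (instance_size n) + (2 * k + 3 + answer_size q n) +
     Suc (10 * (2 * n + 3 + answer_size q n + strat_size q n))"

definition sweep_time :: "nat \<Rightarrow> nat poly \<Rightarrow> nat \<Rightarrow> nat" where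
  "sweep_time k q n = (pairs_size n + 5) + (n * n * Suc (try_time k q n) + 1)"

definition initialize_time :: "nat \<Rightarrow> nat" where
  "initialize_time n = (7 * n + 22) + 2 * (Suc n + (n * Suc (4 * n + 4) + 1)) +
     (Suc n + (n * Suc (3 * n + 4 + n * Suc (4 * n + 5 + pairs_size n)) + 1))"

definition solve_time :: "nat \<Rightarrow> nat poly \<Rightarrow> nat \<Rightarrow> nat" where
  "solve_time k q n = initialize_time n + (Suc (n * n) * Suc (sweep_time k q n) + 1)"

lemma poly_bounded_solve:
  shows "poly_bounded (solve_time k q)" and "poly_bounded pairs_size"
    and "poly_bounded (strat_size q)"
  unfolding solve_time_def initialize_time_def sweep_time_def try_time_def strat_size_def
    answer_size_def instance_size_def pairs_size_def
  by (intro poly_bounded_intros)+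

lemma runs_collect_names:
  assumes "distinct [t, p, D]" "s t = data_list (map (\<lambda>x. Node (f x) (g x)) xs)"
    and "s D = Leaf" "data_size (s t) \<le> n"
  shows "runs (collect_names t p D) s (n * Suc (4 * n + 4) + 1)
    (\<lambda>s'. s' D = data_list (map f (rev xs)) \<and> (\<forall>v. v \<notin> {t, p, D} \<longrightarrow> s' v = s v))"
proof -
  let ?d = "\<lambda>xs. data_list (map (\<lambda>x. Node (f x) (g x)) xs)"
  define I where "I as s' \<longleftrightarrow> (\<exists>zs. xs = zs @ as \<and> s' t = ?d as \<and>
      s' D = data_list (map f (rev zs)) \<and> (\<forall>v. v \<notin> {t, p, D} \<longrightarrow> s' v = s v))" for as s'
  have mono: "data_size (data_list (map f zs)) \<le> data_size (?d zs)" for zs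
    by (induction zs) auto
  have step: "runs (Take_Left p t ;; Take_Left p p ;; Make_Node D p D ;; Take_Right t t)
      s' (4 * n + 4) (I as)" if "I (a # as) s'" for a as s'
  proof (rule runs_straight)
    from that obtain zs where zs: "xs = zs @ a # as" "s' t = ?d (a # as)"
      "s' D = data_list (map f (rev zs))" "\<forall>v. v \<notin> {t, p, D} \<longrightarrow> s' v = s v"
      unfolding I_def by blast
    \<comment> \<open>The two lists share the final \<open>Leaf\<close>, hence the 1. Names gathered
      so far and input still unread thus fit together into n + 1.\<close>
    have split: "data_size (?d (zs @ a # as)) + 1 = data_size (?d zs) + data_size (?d (a # as))"
      by (simp add: data_size_data_list)
    have "data_size (?d zs) + data_size (?d (a # as)) \<le> Suc n"
      using split assms(2,4) zs(1) by simp
    moreover have "data_size (data_list (map f (rev zs))) \<le> data_size (?d zs)"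
      using mono[of zs] by (simp add: data_size_data_list_rev flip: rev_map)
    ultimately show "cost (Take_Left p t ;; Take_Left p p ;; Make_Node D p D ;; Take_Right t t) s'
        \<le> 4 * n + 4"
      using assms(1) zs(2,3) by simp
    show "I as (effect (Take_Left p t ;; Take_Left p p ;; Make_Node D p D ;; Take_Right t t) s')"
      unfolding I_def using zs assms(1) by (intro exI[of _ "zs @ [a]"]) auto
  qed simp
  have "runs (collect_names t p D) s (length xs * Suc (4 * n + 4) + 1) (I [])"
    unfolding collect_names_def
    by (rule runs_foreach[where I = I]) (use step assms(2,3) in \<open>auto simp: I_def\<close>)
  moreover have "length xs \<le> n"
    using length_le_data_size_data_list[of "map (\<lambda>x. Node (f x) (g x)) xs"] assms(2,4) by simp
  ultimately show ?thesis
    by (elim runs_weaken) (auto simp: I_def simp del: mult_Suc_right)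
qed

section \<open>The solver as a subroutine\<close>

locale solver =
  fixes F :: "'u set \<Rightarrow> 'f set" and \<Lambda> :: "('u, 'f) lifting set" and nm :: "'u \<Rightarrow> data"
    and CF :: "'u set \<Rightarrow> 'f coding" and CL :: "('u, 'f) lifting coding"
    and c :: com and k :: nat and q :: "nat poly"
  assumes max_var: "max_var c \<le> k"
    and solves: "solver_instance F nm CF d i \<Longrightarrow>
      \<exists>t s. exec c (initial_store d) t s \<and> t \<le> poly q (data_size d) \<and> solver_output \<Lambda> nm CL i (s 0)"
begin

text \<open>After the reset the store looks initial up to \<open>k\<close>, so
  \<open>exec_frame\<close> transfers the solver's run. The query size enters through a bound
  \<open>m\<close>, which makes the cost the same for all calls.\<close>

lemma runs_call:
  assumes "solver_instance F nm CF (s v) i" "v > k" "data_size (s v) \<le> m"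
  shows "runs (call k c v) s (2 * k + 3 + (m + poly q m))
    (\<lambda>s'. solver_output \<Lambda> nm CL i (s' 0) \<and> data_size (s' 0) \<le> m + poly q m \<and>
       (\<forall>v>k. s' v = s v))"
  unfolding call_def
proof (rule runs_Seq)
  let ?r = "clear_upto k ;; Copy 0 v"
  show "runs ?r s (2 * k + 3 + m)
      (\<lambda>s'. (\<forall>v'\<le>k. s' v' = initial_store (s v) v') \<and> (\<forall>v>k. s' v = s v))"
    by (rule runs_straight)
      (use assms in \<open>auto simp: straight_clear_upto effect_clear_upto cost_clear_upto initial_store_def\<close>)
  fix s'
  assume s': "(\<forall>v'\<le>k. s' v' = initial_store (s v) v') \<and> (\<forall>v>k. s' v = s v)"
  from solves[OF assms(1)] obtain t s1 where
    ex: "exec c (initial_store (s v)) t s1" "t \<le> poly q (data_size (s v))"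
      "solver_output \<Lambda> nm CL i (s1 0)" by blast
  from exec_frame[OF ex(1) max_var, of s'] s' obtain s2 where
    s2: "exec c s' t s2" "s2 0 = s1 0" "\<forall>v>k. s2 v = s' v" by auto
  have t: "t \<le> poly q m" using ex(2) poly_nat_mono[OF assms(3)] le_trans by blast
  have "data_size (s1 0) \<le> m + poly q m"
    using exec_size[OF ex(1), of 0] t assms(3) by (simp add: initial_store_def)
  then show "runs c s' (poly q m) (\<lambda>s'. solver_output \<Lambda> nm CL i (s' 0) \<and>
      data_size (s' 0) \<le> m + poly q m \<and> (\<forall>v>k. s' v = s v))"
    unfolding runs_def using s2 t ex(3) s' by metis
qed simp

end

section \<open>The program on one game instance: sizes and invariants\<close>

locale game = solver F \<Lambda> nm CF CL c k q
  for F :: "'u set \<Rightarrow> 'f set" and \<Lambda> nm CF CL c k q +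
  fixes X Y :: "'u set" and \<xi> \<zeta> :: "'u \<Rightarrow> 'f" and \<epsilon> :: rat
    and xs ys :: "'u list" and cx cy :: "'u \<Rightarrow> data" and n :: nat
  assumes eps: "0 \<le> \<epsilon>" and coalg: "\<xi> \<in> X \<rightarrow> F X" "\<zeta> \<in> Y \<rightarrow> F Y"
    and xs: "distinct xs" "set xs = X" and ys: "distinct ys" "set ys = Y"
    and cx: "x \<in> X \<Longrightarrow> CF X (cx x) (\<xi> x)" and cy: "y \<in> Y \<Longrightarrow> CF Y (cy y) (\<zeta> y)"
    and size: "data_size (data_rat \<epsilon>) \<le> n"
      "data_size (data_list (map (\<lambda>x. Node (nm x) (cx x)) xs)) \<le> n"
      "data_size (data_list (map (\<lambda>y. Node (nm y) (cy y)) ys)) \<le> n"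
begin

abbreviation entry1 :: "'u \<Rightarrow> data" where "entry1 x \<equiv> Node (nm x) (cx x)"
abbreviation entry2 :: "'u \<Rightarrow> data" where "entry2 y \<equiv> Node (nm y) (cy y)"

text \<open>Format of the worklists, which must supply transition codes; \<open>name\<close> is the
  format of won positions, shared by queries and output.\<close>

definition entry :: "'u \<times> 'u \<Rightarrow> data" where
  "entry = (\<lambda>(x, y). Node (entry1 x) (entry2 y))"

definition name :: "'u \<times> 'u \<Rightarrow> data" where
  "name = (\<lambda>(x, y). Node (nm x) (nm y))"

abbreviation strat_code :: "(('u \<times> 'u) \<times> 'u set \<times> 'u set) coding" where
  "strat_code \<equiv> code_pair (code_pair (code_by nm) (code_by nm))
     (code_pair (code_set (code_by nm)) (code_set (code_by nm)))"

abbreviation names1 where "names1 \<equiv> data_list (map nm (rev xs))"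
abbreviation names2 where "names2 \<equiv> data_list (map nm (rev ys))"

lemma size_entries: "x \<in> X \<Longrightarrow> data_size (entry1 x) \<le> n" "y \<in> Y \<Longrightarrow> data_size (entry2 y) \<le> n"
proof -
  show "data_size (entry1 x) \<le> n" if "x \<in> X" for x
    using data_size_le_data_list[of "entry1 x" "map entry1 xs"] size(2) that xs(2) by fastforce
  show "data_size (entry2 y) \<le> n" if "y \<in> Y" for y
    using data_size_le_data_list[of "entry2 y" "map entry2 ys"] size(3) that ys(2) by fastforce
qed

lemma size_names: "data_size names1 \<le> n" "data_size names2 \<le> n"
proof -
  have mono: "data_size (data_list (map nm zs)) \<le> data_size (data_list (map (\<lambda>x. Node (nm x) (f x)) zs))"
    for f zs by (induction zs) auto
  show "data_size names1 \<le> n"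
    using mono[of xs cx] size(2) by (simp add: data_size_data_list_rev flip: rev_map)
  show "data_size names2 \<le> n"
    using mono[of ys cy] size(3) by (simp add: data_size_data_list_rev flip: rev_map)
qed

lemma length_le: "length xs \<le> n" "length ys \<le> n"
  using length_le_data_size_data_list[of "map entry1 xs"] size(2)
    length_le_data_size_data_list[of "map entry2 ys"] size(3) by auto

text \<open>This is where the absence of repetitions pays off: one bound serves worklists, won
  positions, strategy and number of sweeps.\<close>

lemma length_pairs:
  assumes "distinct ps" "set ps \<subseteq> X \<times> Y"
  shows "length ps \<le> n * n"
proof -
  have "length ps = card (set ps)" using assms(1) by (simp add: distinct_card)
  also have "\<dots> \<le> card (X \<times> Y)"
    using assms(2) xs(2) ys(2) by (intro card_mono) auto
  also have "\<dots> = length xs * length ys"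
    using xs ys by (metis card_cartesian_product distinct_card)
  also have "\<dots> \<le> n * n" using length_le by (rule mult_le_mono)
  finally show ?thesis .
qed

text \<open>A pair has size at most 2 * n + 1, and each list cell adds 1.\<close>

lemma size_pairs:
  assumes "distinct ps" "set ps \<subseteq> X \<times> Y"
  shows "data_size (data_list (map entry ps)) \<le> pairs_size n"
    and "data_size (data_list (map name ps)) \<le> pairs_size n"
proof -
  have e: "data_size (entry p) \<le> 2 * n + 1 \<and> data_size (name p) \<le> 2 * n + 1" if "p \<in> X \<times> Y" for p
    using that size_entries(1)[of "fst p"] size_entries(2)[of "snd p"] by (auto simp: entry_def name_def)
  have l: "Suc (length ps * Suc (2 * n + 1)) \<le> pairs_size n"
    unfolding pairs_size_def using mult_le_mono1[OF length_pairs[OF assms], of "2 * n + 2"] by simp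
  show "data_size (data_list (map entry ps)) \<le> pairs_size n"
    using data_size_data_list_le[of "map entry ps" "2 * n + 1"] e assms(2) l by fastforce
  show "data_size (data_list (map name ps)) \<le> pairs_size n"
    using data_size_data_list_le[of "map name ps" "2 * n + 1"] e assms(2) l by fastforce
qed

text \<open>
  \<open>T\<close> are the positions still to be tried in this sweep, \<open>R\<close> those already tried without success.
\<close>

definition invar :: "('u \<times> 'u) list \<Rightarrow> ('u \<times> 'u) list \<Rightarrow> (('u \<times> 'u) \<times> 'u set \<times> 'u set) list \<Rightarrow>
    store \<Rightarrow> bool" where
  "invar T R ml s \<longleftrightarrow>
     s (eps_var k) = data_rat \<epsilon> \<and> s (names1_var k) = names1 \<and> s (names2_var k) = names2 \<and>
     s (rest_var k) = data_list (map entry R) \<and>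
     s (won_var k) = data_list (map name (map fst ml)) \<and>
     (\<exists>ds. s (strat_var k) = data_list ds \<and> list_all2 strat_code ds ml \<and>
        (\<forall>d\<in>set ds. data_size d \<le> 2 * n + 2 + answer_size q n)) \<and>
     justified \<Lambda> X Y \<xi> \<zeta> (of_rat \<epsilon>) ml \<and>
     distinct (T @ R @ map fst ml) \<and> set (T @ R @ map fst ml) = X \<times> Y"

definition winnable :: "('u \<times> 'u) set \<Rightarrow> 'u \<times> 'u \<Rightarrow> bool" where
  "winnable S = (\<lambda>(x, y). \<exists>w. solver_witness \<Lambda> (\<epsilon>, X, Y, \<xi> x, \<zeta> y, S) w)"

text \<open>\<open>m\<close> bounds the number of further sweeps: a raised flag means that a position has been won.\<close>

definition sweep_invar :: "nat \<Rightarrow> ('u \<times> 'u) list \<Rightarrow> store \<Rightarrow> bool" where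
  "sweep_invar m T s \<longleftrightarrow> (\<exists>R ml.
     invar T R ml s \<and> length T + length R \<le> m \<and>
     (if s (flag_var k) = Leaf then \<forall>p\<in>set R. \<not> winnable (fst ` set ml) p
      else length T + length R < m))"

lemma runs_initialize:
  assumes "s 0 = Node (data_rat \<epsilon>) (Node (data_list (map entry1 xs)) (data_list (map entry2 ys)))"
  shows "runs (initialize k) s (initialize_time n)
    (\<lambda>s'. invar [] (rev (List.product xs ys)) [] s' \<and> s' (flag_var k) \<noteq> Leaf)"
proof -
  let ?gx = "data_list (map entry1 xs)" and ?gy = "data_list (map entry2 ys)"
  define P where "P s' \<longleftrightarrow> s' (eps_var k) = data_rat \<epsilon> \<and> s' (graph1_var k) = ?gx \<and>
      s' (graph2_var k) = ?gy \<and> s' (rest_var k) = Leaf \<and> s' (won_var k) = Leaf \<and>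
      s' (strat_var k) = Leaf \<and> s' (flag_var k) \<noteq> Leaf" for s' :: store
  have unpack: "runs (unpack k) s (7 * n + 22)
      (\<lambda>s'. P s' \<and> s' (names1_var k) = Leaf \<and> s' (names2_var k) = Leaf)"
    by (rule runs_straight)
      (use assms size in \<open>auto simp: unpack_def P_def\<close>)
  have collect1: "runs (collect_names (t_var k) (p_var k) (names1_var k)) s'
      (n * Suc (4 * n + 4) + 1)
      (\<lambda>s'. P s' \<and> s' (names1_var k) = names1 \<and> s' (names2_var k) = Leaf)"
    if "P s' \<and> s' (names1_var k) = Leaf \<and> s' (names2_var k) = Leaf \<and> s' (t_var k) = ?gx" for s'
    by (rule runs_weaken[OF runs_collect_names[where n = n]])
      (use that size in \<open>auto simp: P_def\<close>)
  have collect2: "runs (collect_names (t_var k) (p_var k) (names2_var k)) s'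
      (n * Suc (4 * n + 4) + 1)
      (\<lambda>s'. P s' \<and> s' (names1_var k) = names1 \<and> s' (names2_var k) = names2)"
    if "P s' \<and> s' (names1_var k) = names1 \<and> s' (names2_var k) = Leaf \<and> s' (t_var k) = ?gy" for s'
    by (rule runs_weaken[OF runs_collect_names[where n = n]])
      (use that size in \<open>auto simp: P_def\<close>)
  define Q where "Q R s' \<longleftrightarrow> s' (eps_var k) = data_rat \<epsilon> \<and>
      s' (graph2_var k) = ?gy \<and> s' (rest_var k) = data_list (map entry R) \<and> s' (won_var k) = Leaf \<and>
      s' (strat_var k) = Leaf \<and> s' (flag_var k) \<noteq> Leaf \<and>
      s' (names1_var k) = names1 \<and> s' (names2_var k) = names2" for R and s' :: store
  \<comment> \<open>Outer loop: the rows for \<open>zs\<close> are complete.\<close>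
  define I where "I as s' \<longleftrightarrow> (\<exists>zs. xs = zs @ as \<and> s' (t_var k) = data_list (map entry1 as) \<and>
      Q (rev (List.product zs ys)) s')" for as s'
  \<comment> \<open>Inner loop: in addition, the row of \<open>x\<close> has been filled up to
    \<open>ws\<close>.\<close>
  define J where "J zs x as bs s' \<longleftrightarrow> (\<exists>ws. ys = ws @ bs \<and> s' (t_var k) = data_list (map entry1 (x # as)) \<and>
      s' (p_var k) = entry1 x \<and> s' (u_var k) = data_list (map entry2 bs) \<and>
      Q (rev (List.product zs ys @ map (Pair x) ws)) s')" for zs x as bs s'
  have tail: "data_size (data_list (map entry1 as)) \<le> n" if "xs = zs @ as" for zs as
    using size(2) that by (simp add: data_size_data_list)
  have inner: "runs (Take_Left (a_var k) (u_var k) ;; Make_Node (a_var k) (p_var k) (a_var k) ;;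
         Make_Node (rest_var k) (a_var k) (rest_var k) ;; Take_Right (u_var k) (u_var k)) s'
      (4 * n + 5 + pairs_size n) (J zs x as bs)"
    if J: "J zs x as (y # bs) s'" and zs: "xs = zs @ x # as" for zs x as y bs s'
  proof (rule runs_straight)
    let ?c = "Take_Left (a_var k) (u_var k) ;; Make_Node (a_var k) (p_var k) (a_var k) ;;
         Make_Node (rest_var k) (a_var k) (rest_var k) ;; Take_Right (u_var k) (u_var k)"
    from J obtain ws where ws: "ys = ws @ y # bs" "s' (t_var k) = data_list (map entry1 (x # as))"
      "s' (p_var k) = entry1 x" "s' (u_var k) = data_list (map entry2 (y # bs))"
      "Q (rev (List.product zs ys @ map (Pair x) ws)) s'" unfolding J_def by blast
    let ?R = "rev (List.product zs ys @ map (Pair x) (ws @ [y]))"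
    have "distinct ?R" "set ?R \<subseteq> X \<times> Y"
      using zs xs ys ws(1) by (auto simp: distinct_product distinct_map inj_on_def)
    from size_pairs(1)[OF this] have "data_size (data_list (map entry ?R)) \<le> pairs_size n" .
    moreover have "data_size (entry1 x) \<le> n" "data_size (entry2 y) \<le> n"
      using size_entries(1)[of x] size_entries(2)[of y] zs ws(1) xs ys by auto
    moreover have "data_size (data_list (map entry2 bs)) \<le> n"
      using size(3) ws(1) by (simp add: data_size_data_list)
    ultimately show "cost ?c s' \<le> 4 * n + 5 + pairs_size n"
      using ws(3,4,5) by (simp add: Q_def entry_def)
    show "J zs x as bs (effect ?c s')"
      unfolding J_def using ws by (intro exI[of _ "ws @ [y]"]) (auto simp: Q_def entry_def)
  qed simp
  have outer: "runs
     (Take_Left (p_var k) (t_var k) ;; Copy (u_var k) (graph2_var k) ;;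
      While_Node (u_var k)
        (Take_Left (a_var k) (u_var k) ;; Make_Node (a_var k) (p_var k) (a_var k) ;;
         Make_Node (rest_var k) (a_var k) (rest_var k) ;; Take_Right (u_var k) (u_var k)) ;;
      Take_Right (t_var k) (t_var k)) s'
      (3 * n + 4 + n * Suc (4 * n + 5 + pairs_size n)) (I as)"
    if I: "I (x # as) s'" for x as s'
  proof -
    from I obtain zs where zs: "xs = zs @ x # as" "s' (t_var k) = data_list (map entry1 (x # as))"
      "Q (rev (List.product zs ys)) s'" unfolding I_def by blast
    have x: "data_size (entry1 x) \<le> n" using zs(1) xs size_entries(1)[of x] by auto
    let ?l = "length ys * Suc (4 * n + 5 + pairs_size n) + 1"
    show ?thesis
    proof (rule runs_Seq[where b = "Suc n" and b' = "Suc n + (?l + Suc n)" and Q = "\<lambda>s'. s' (p_var k) = entry1 x \<and>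
        s' (t_var k) = data_list (map entry1 (x # as)) \<and> Q (rev (List.product zs ys)) s'"],
        goal_cases)
      case 1
      show ?case by (rule runs_straight) (use zs x in \<open>auto simp: Q_def\<close>)
    next
      case (2 s1)
      show ?case
      proof (rule runs_Seq[where b = "Suc n" and b' = "?l + Suc n" and Q = "J zs x as ys"], goal_cases)
        case 1
        show ?case by (rule runs_straight) (use 2 size(3) in \<open>auto simp: J_def Q_def\<close>)
      next
        case (2 s2)
        show ?case
        proof (rule runs_Seq[where b = ?l and b' = "Suc n" and Q = "J zs x as []"], goal_cases)
          case 1
          show ?case
            by (rule runs_foreach[where I = "J zs x as"])
              (use inner[OF _ zs(1)] 2 in \<open>auto simp: J_def\<close>)
        next
          case (2 s3)
          show ?case
          proof (rule runs_straight[where b = "Suc n"])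
            show "I as (effect (Take_Right (t_var k) (t_var k)) s3)"
              unfolding I_def using 2 zs(1)
              by (intro exI[of _ "zs @ [x]"]) (auto simp: J_def Q_def product_concat_map)
            show "cost (Take_Right (t_var k) (t_var k)) s3 \<le> Suc n"
              using 2 tail[of "zs @ [x]" as] zs(1) by (auto simp: J_def)
          qed simp
        qed (rule order_refl)
      qed (rule order_refl)
    next
      case 3
      have "length ys * Suc (4 * n + 5 + pairs_size n) \<le> n * Suc (4 * n + 5 + pairs_size n)"
        using length_le(2) by (rule mult_le_mono1)
      then show ?case by linarith
    qed
  qed
  have pairs: "runs (pair_up k) s' (n * Suc (3 * n + 4 + n * Suc (4 * n + 5 + pairs_size n)) + 1)
      (Q (rev (List.product xs ys)))"
    if "I xs s'" for s'
  proof (rule runs_weaken)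
    show "runs (pair_up k) s' (length xs * Suc (3 * n + 4 + n * Suc (4 * n + 5 + pairs_size n)) + 1)
      (I [])"
      unfolding pair_up_def
      by (rule runs_foreach[where I = I]) (use outer that in \<open>auto simp: I_def\<close>)
    show "length xs * Suc (3 * n + 4 + n * Suc (4 * n + 5 + pairs_size n)) + 1 \<le>
        n * Suc (3 * n + 4 + n * Suc (4 * n + 5 + pairs_size n)) + 1"
      using mult_le_mono1[OF length_le(1)] add_le_mono1 by blast
  qed (auto simp: I_def)
  have copy: "runs (Copy (t_var k) v) s' (Suc n) (\<lambda>s''. s'' = s'(t_var k := s' v))"
    if "data_size (s' v) \<le> n" for s' v
    by (rule runs_straight) (use that in auto)
  let ?c = "Suc n" and ?l = "n * Suc (4 * n + 4) + 1"
    and ?p = "n * Suc (3 * n + 4 + n * Suc (4 * n + 5 + pairs_size n)) + 1"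
  have "runs (initialize k) s (initialize_time n) (Q (rev (List.product xs ys)))"
    unfolding initialize_def
  proof (rule runs_Seq[where b' = "?c + (?l + (?c + (?l + (?c + ?p))))", OF unpack], goal_cases)
    case (1 s1)
    show ?case
    proof (rule runs_Seq[where b' = "?l + (?c + (?l + (?c + ?p)))", OF copy], goal_cases)
      case 1
      then show ?case using \<open>P s1 \<and> _\<close> size by (simp add: P_def)
    next
      case (2 s2)
      show ?case
      proof (rule runs_Seq[where b' = "?c + (?l + (?c + ?p))", OF collect1], goal_cases)
        case 1
        show ?case using 2 \<open>P s1 \<and> _\<close> by (auto simp: P_def)
      next
        case (2 s3)
        show ?case
        proof (rule runs_Seq[where b' = "?l + (?c + ?p)", OF copy], goal_cases)
          case 1
          show ?case using 2 size by (auto simp: P_def)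
        next
          case (2 s4)
          show ?case
          proof (rule runs_Seq[where b' = "?c + ?p", OF collect2], goal_cases)
            case 1
            show ?case using 2 \<open>P s3 \<and> _\<close> by (auto simp: P_def)
          next
            case (2 s5)
            show ?case
            proof (rule runs_Seq[where b' = "?p", OF copy], goal_cases)
              case 1
              show ?case using 2 size by (auto simp: P_def)
            next
              case (2 s6)
              show ?case
                by (rule pairs) (use 2 \<open>P s5 \<and> _\<close> in \<open>auto simp: P_def I_def Q_def\<close>)
            qed (rule order_refl)
          qed (rule order_refl)
        qed (rule order_refl)
      qed (rule order_refl)
    qed (rule order_refl)
  qed (simp add: initialize_time_def)
  then show ?thesis
  proof (rule runs_weaken)
    fix s' assume "Q (rev (List.product xs ys)) s'"
    then show "invar [] (rev (List.product xs ys)) [] s' \<and> s' (flag_var k) \<noteq> Leaf"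
      using xs ys by (auto simp: Q_def invar_def distinct_product intro!: exI[of _ "[]"])
  qed simp
qed

lemma list_all2_name: "list_all2 (code_pair (code_by nm) (code_by nm)) (map name ps) ps"
  by (simp add: code_pair_def code_by_def name_def list_all2_map1 list.rel_refl split_beta)

text \<open>Since \<open>code_set\<close> demands enumerations without repetitions, the list of won
  positions must be distinct to be usable as S.\<close>

lemma solver_instance_prepared:
  assumes "x \<in> X" "y \<in> Y" "distinct ps" "set ps \<subseteq> X \<times> Y"
  shows "solver_instance F nm CF
    (Node (data_rat \<epsilon>) (Node names1 (Node names2 (Node (cx x) (Node (cy y) (data_list (map name ps)))))))
    (\<epsilon>, X, Y, \<xi> x, \<zeta> y, set ps)"
proof -
  have "code_set (code_by nm) (data_list (map nm (rev zs))) Z" if "distinct zs" "set zs = Z" for zs Z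
    using code_setI[of "code_by nm" "map nm (rev zs)" "rev zs"] that
    by (simp add: code_by_def list_all2_map1 list.rel_refl)
  from this[OF xs] this[OF ys]
  have "code_set (code_by nm) names1 X" "code_set (code_by nm) names2 Y" .
  moreover have "code_set (code_pair (code_by nm) (code_by nm)) (data_list (map name ps)) (set ps)"
    using list_all2_name assms(3) by (rule code_setI)
  ultimately show ?thesis
    using assms eps xs(2) ys(2) coalg cx cy
    by (auto simp: solver_instance_def code_pair_def code_by_def[of data_rat])
qed

text \<open>The lifting is existentially quantified in the game move too, so a query asks for
  nothing but a move of Spoiler whose answers all lie in S.\<close>

lemma winnable_iff:
  assumes "(x, y) \<in> X \<times> Y"
  shows "winnable S (x, y) \<longleftrightarrow> (\<exists>A B.
    codensity_move \<Lambda> X \<xi> Y \<zeta> (of_rat \<epsilon>) (Spoiler x y) (Duplicator A B) \<and> A \<times> (Y - B) \<subseteq> S)"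
  using assms unfolding winnable_def solver_witness_def
  by (auto simp: codensity_move.simps)

text \<open>The position has left \<open>todo_var\<close> but still counts as untried in the
  invariant, since it is decided only after the call.\<close>

lemma runs_prepare_instance:
  assumes "invar ((x, y) # T) R ml s" "s (todo_var k) = data_list (map entry ((x, y) # T))"
  shows "runs (prepare_instance k) s (13 * Suc (instance_size n))
    (\<lambda>s'. invar ((x, y) # T) R ml s' \<and> s' (todo_var k) = data_list (map entry T) \<and>
       s' (flag_var k) = s (flag_var k) \<and> s' (p_var k) = entry (x, y) \<and>
       s' (a_var k) = nm x \<and> s' (b_var k) = nm y \<and>
       solver_instance F nm CF (s' (inst_var k)) (\<epsilon>, X, Y, \<xi> x, \<zeta> y, fst ` set ml) \<and>
       data_size (s' (inst_var k)) \<le> instance_size n)"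
proof (rule runs_straight)
  let ?ps = "map fst ml"
  let ?i = "Node (data_rat \<epsilon>) (Node names1 (Node names2
    (Node (cx x) (Node (cy y) (data_list (map name ?ps))))))"
  have xy: "x \<in> X" "y \<in> Y" and ps: "distinct ?ps" "set ?ps \<subseteq> X \<times> Y"
    and T: "distinct T" "set T \<subseteq> X \<times> Y"
    using assms(1) unfolding invar_def by auto
  have sizes: "data_size (nm x) + data_size (cx x) < n" "data_size (nm y) + data_size (cy y) < n"
    using size_entries(1)[OF xy(1)] size_entries(2)[OF xy(2)] by auto
  have i: "data_size ?i \<le> instance_size n"
    using size(1) size_names sizes size_pairs(2)[OF ps] by (simp add: instance_size_def)
  have T': "data_size (data_list (map entry T)) \<le> pairs_size n" by (rule size_pairs(1)[OF T])
  show "cost (prepare_instance k) s \<le> 13 * Suc (instance_size n)"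
    using assms i T' sizes
    by (simp add: prepare_instance_def invar_def entry_def instance_size_def)
  have e: "effect (prepare_instance k) s (inst_var k) = ?i"
    using assms by (simp add: prepare_instance_def invar_def entry_def)
  have "invar ((x, y) # T) R ml (effect (prepare_instance k) s)"
    using assms(1) by (simp add: invar_def prepare_instance_def)
  then show "invar ((x, y) # T) R ml (effect (prepare_instance k) s) \<and>
      effect (prepare_instance k) s (todo_var k) = data_list (map entry T) \<and>
      effect (prepare_instance k) s (flag_var k) = s (flag_var k) \<and>
      effect (prepare_instance k) s (p_var k) = entry (x, y) \<and>
      effect (prepare_instance k) s (a_var k) = nm x \<and>
      effect (prepare_instance k) s (b_var k) = nm y \<and>
      solver_instance F nm CF (effect (prepare_instance k) s (inst_var k))
        (\<epsilon>, X, Y, \<xi> x, \<zeta> y, fst ` set ml) \<and>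
      data_size (effect (prepare_instance k) s (inst_var k)) \<le> instance_size n"
    using solver_instance_prepared[OF xy ps] i assms(2) unfolding e
    by (simp add: prepare_instance_def entry_def)
qed (simp add: prepare_instance_def)

lemma runs_record_win:
  assumes "invar ((x, y) # T) R ml s" "s (a_var k) = nm x" "s (b_var k) = nm y"
    and "s 0 = Node Leaf e" "data_size (s 0) \<le> answer_size q n"
    and "solver_witness \<Lambda> (\<epsilon>, X, Y, \<xi> x, \<zeta> y, fst ` set ml) (A, B, l)"
    and "code_pair (code_set (code_by nm)) (code_pair (code_set (code_by nm)) CL) e (A, B, l)"
  shows "runs (record_win k) s (10 * (2 * n + 3 + answer_size q n + strat_size q n))
    (\<lambda>s'. invar T R (((x, y), (A, B)) # ml) s' \<and> s' (todo_var k) = s (todo_var k) \<and>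
       s' (flag_var k) \<noteq> Leaf)"
proof (rule runs_straight)
  let ?ml = "((x, y), (A, B)) # ml" and ?m = "2 * n + 2 + answer_size q n"
  have xy: "x \<in> X" "y \<in> Y" and ps: "distinct (map fst ?ml)" "set (map fst ?ml) \<subseteq> X \<times> Y"
    using assms(1) unfolding invar_def by auto
  obtain dA dB dl where e: "e = Node dA (Node dB dl)"
    and AB: "code_set (code_by nm) dA A" "code_set (code_by nm) dB B"
    using assms(7) by (auto simp: code_pair_def)
  obtain ds where ds: "s (strat_var k) = data_list ds" "list_all2 strat_code ds ml"
    "\<forall>d\<in>set ds. data_size d \<le> ?m"
    using assms(1) unfolding invar_def by blast
  let ?d = "Node (Node (nm x) (nm y)) (Node dA dB)"
  have sizes: "data_size (nm x) < n" "data_size (nm y) < n"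
    using size_entries(1)[OF xy(1)] size_entries(2)[OF xy(2)] by auto
  have d: "data_size ?d \<le> ?m" using sizes assms(4,5) e by simp
  have ds': "list_all2 strat_code (?d # ds) ?ml"
    using ds(2) AB by (simp add: code_pair_def code_by_def)
  have "length (?d # ds) = length (map fst ?ml)" using list_all2_lengthD[OF ds'] by simp
  then have len: "length (?d # ds) \<le> n * n" using length_pairs[OF ps] by simp
  have "data_size (data_list (?d # ds)) \<le> Suc (length (?d # ds) * Suc ?m)"
    using d ds(3) by (intro data_size_data_list_le) auto
  also have "\<dots> \<le> strat_size q n"
    unfolding strat_size_def using mult_le_mono1[OF len, of "Suc ?m"] by (simp add: algebra_simps)
  finally have M: "data_size (data_list (?d # ds)) \<le> strat_size q n" .
  have W: "data_size (data_list (map name (map fst ?ml))) \<le> answer_size q n"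
    using size_pairs(2)[OF ps] by (simp add: answer_size_def instance_size_def)
  have won: "s (won_var k) = data_list (map name (map fst ml))"
    using assms(1) by (simp add: invar_def)
  show "cost (record_win k) s \<le> 10 * (2 * n + 3 + answer_size q n + strat_size q n)"
    using M W sizes assms(2,3,4,5) won ds(1)
    by (simp add: record_win_def e name_def)
  \<comment> \<open>The inclusion promised by the witness is literally what \<open>justified\<close>
    asks of a new head.\<close>
  have move: "codensity_move \<Lambda> X \<xi> Y \<zeta> (of_rat \<epsilon>) (Spoiler x y) (Duplicator A B)"
    "A \<times> (Y - B) \<subseteq> fst ` set ml"
    using assms(6) xy by (auto simp: solver_witness_def intro: codensity_move.intros)
  have "effect (record_win k) s (strat_var k) = data_list (?d # ds)"
    using assms(2,3,4) ds(1) by (simp add: record_win_def e)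
  with ds' d ds(3) have "\<exists>ds. effect (record_win k) s (strat_var k) = data_list ds \<and>
      list_all2 strat_code ds ?ml \<and> (\<forall>d\<in>set ds. data_size d \<le> ?m)"
    by (intro exI[of _ "?d # ds"]) auto
  moreover have "distinct (T @ R @ map fst ?ml)" "set (T @ R @ map fst ?ml) = X \<times> Y"
    using assms(1) by (auto simp: invar_def)
  moreover have "justified \<Lambda> X Y \<xi> \<zeta> (of_rat \<epsilon>) ?ml"
    using assms(1) move by (simp add: invar_def)
  moreover have "effect (record_win k) s (won_var k) = data_list (map name (map fst ?ml))"
    using assms(2,3) won by (simp add: record_win_def name_def)
  moreover have "effect (record_win k) s v = s v"
    if "v \<in> {eps_var k, names1_var k, names2_var k, rest_var k, todo_var k}" for v
    using that by (auto simp: record_win_def)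
  moreover have "effect (record_win k) s (flag_var k) \<noteq> Leaf"
    using assms(4) by (simp add: record_win_def)
  ultimately show "invar T R ?ml (effect (record_win k) s) \<and>
      effect (record_win k) s (todo_var k) = s (todo_var k) \<and>
      effect (record_win k) s (flag_var k) \<noteq> Leaf"
    using assms(1) unfolding invar_def by simp
qed (simp add: record_win_def)

lemma invar_cong:
  assumes "invar T R ml s"
    and "\<And>v. v \<in> {eps_var k, names1_var k, names2_var k, rest_var k, won_var k, strat_var k} \<Longrightarrow>
      s' v = s v"
  shows "invar T R ml s'"
  using assms unfolding invar_def by simp

text \<open>A failure leaves \<open>ml\<close> unchanged, so with the flag down the earlier failures
  still concern the current S. A win enlarges S and may invalidate them, but it raises the flag, and
  then nothing is claimed about failures.\<close>

lemma runs_try_position: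
  assumes "sweep_invar m (p # T) s" "s (todo_var k) = data_list (map entry (p # T))"
  shows "runs (try_position k c) s (try_time k q n)
    (\<lambda>s'. sweep_invar m T s' \<and> s' (todo_var k) = data_list (map entry T))"
proof -
  obtain x y where p: "p = (x, y)" by fastforce
  note todo = assms(2)[unfolded p]
  from assms(1) obtain R ml where inv: "invar ((x, y) # T) R ml s" "length (p # T) + length R \<le> m"
    "if s (flag_var k) = Leaf then \<forall>p\<in>set R. \<not> winnable (fst ` set ml) p
      else length (p # T) + length R < m"
    unfolding sweep_invar_def p by blast
  define i where "i = (\<epsilon>, X, Y, \<xi> x, \<zeta> y, fst ` set ml)"
  define P where "P s' \<longleftrightarrow> invar ((x, y) # T) R ml s' \<and> s' (todo_var k) = data_list (map entry T) \<and>
       s' (flag_var k) = s (flag_var k) \<and> s' (p_var k) = entry (x, y) \<and>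
       s' (a_var k) = nm x \<and> s' (b_var k) = nm y" for s'
  show ?thesis
    unfolding try_position_def
  proof (rule runs_Seq[where b' = "(2 * k + 3 + answer_size q n) +
          Suc (10 * (2 * n + 3 + answer_size q n + strat_size q n))",
        OF runs_prepare_instance[OF inv(1) todo]], goal_cases)
    case (1 s1)
    then have s1: "P s1" "solver_instance F nm CF (s1 (inst_var k)) i"
      "data_size (s1 (inst_var k)) \<le> instance_size n"
      unfolding P_def i_def by auto
    show ?case
    proof (rule runs_Seq[where b = "2 * k + 3 + answer_size q n" and
          b' = "Suc (10 * (2 * n + 3 + answer_size q n + strat_size q n))" and
          Q = "\<lambda>s'. P s' \<and> solver_output \<Lambda> nm CL i (s' 0) \<and> data_size (s' 0) \<le> answer_size q n"],
        goal_cases)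
      case 1
      have "runs (call k c (inst_var k)) s1 (2 * k + 3 + (instance_size n + poly q (instance_size n)))
        (\<lambda>s'. solver_output \<Lambda> nm CL i (s' 0) \<and>
          data_size (s' 0) \<le> instance_size n + poly q (instance_size n) \<and> (\<forall>v>k. s' v = s1 v))"
        by (rule runs_call[where s = s1 and v = "inst_var k" and i = i, OF s1(2) _ s1(3)]) simp
      then show ?case
      proof (rule runs_weaken, goal_cases)
        case (1 s')
        have "invar ((x, y) # T) R ml s'"
          by (rule invar_cong[where s = s1]) (use s1(1) 1 in \<open>auto simp: P_def\<close>)
        with s1(1) 1 show ?case by (auto simp: P_def answer_size_def)
      qed (simp add: answer_size_def)
    next
      case (2 s2)
      then have s2: "P s2" "solver_output \<Lambda> nm CL i (s2 0)" "data_size (s2 0) \<le> answer_size q n"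
        by auto
      show ?case
      proof (rule runs_If[where b = "10 * (2 * n + 3 + answer_size q n + strat_size q n)"])
        assume "s2 0 \<noteq> Leaf"
        with s2(2) obtain A B l e where w: "s2 0 = Node Leaf e" "solver_witness \<Lambda> i (A, B, l)"
          "code_pair (code_set (code_by nm)) (code_pair (code_set (code_by nm)) CL) e (A, B, l)"
          unfolding solver_output_def by (metis prod_cases3)
        show "runs (record_win k) s2 (10 * (2 * n + 3 + answer_size q n + strat_size q n))
            (\<lambda>s'. sweep_invar m T s' \<and> s' (todo_var k) = data_list (map entry T))"
        proof (rule runs_weaken[OF runs_record_win])
          fix s' assume "invar T R (((x, y), (A, B)) # ml) s' \<and>
            s' (todo_var k) = s2 (todo_var k) \<and> s' (flag_var k) \<noteq> Leaf"
          \<comment> \<open>The won position is not put back, so the number of open positions falls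
            strictly below \<open>m\<close>, as a raised flag requires.\<close>
          then show "sweep_invar m T s' \<and> s' (todo_var k) = data_list (map entry T)"
            using s2(1) inv(2) unfolding sweep_invar_def P_def
            by (intro conjI exI[of _ R] exI[of _ "((x, y), (A, B)) # ml"]) simp_all
        qed (use s2 w in \<open>auto simp: P_def i_def\<close>)
      next
        assume "s2 0 = Leaf"
        with s2(2) have no: "\<not> winnable (fst ` set ml) (x, y)"
          unfolding solver_output_def i_def winnable_def by (auto split: if_splits)
        show "runs (Make_Node (rest_var k) (p_var k) (rest_var k)) s2
            (10 * (2 * n + 3 + answer_size q n + strat_size q n))
            (\<lambda>s'. sweep_invar m T s' \<and> s' (todo_var k) = data_list (map entry T))"
        proof (rule runs_straight)
          let ?s = "effect (Make_Node (rest_var k) (p_var k) (rest_var k)) s2"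
          have I: "invar ((x, y) # T) R ml s2" using s2(1) by (simp add: P_def)
          have rest: "?s (rest_var k) = data_list (map entry (p # R))"
            using s2(1) by (simp add: P_def invar_def p)
          have "distinct (p # R)" "set (p # R) \<subseteq> X \<times> Y" using I by (auto simp: invar_def p)
          from size_pairs(1)[OF this]
          have "data_size (?s (rest_var k)) \<le> answer_size q n"
            unfolding rest by (simp add: answer_size_def instance_size_def)
          then show "cost (Make_Node (rest_var k) (p_var k) (rest_var k)) s2 \<le>
              10 * (2 * n + 3 + answer_size q n + strat_size q n)" by simp
          have "invar T (p # R) ml ?s"
            using I rest unfolding invar_def p by auto
          then show "sweep_invar m T ?s \<and> ?s (todo_var k) = data_list (map entry T)"
            using s2(1) inv(2,3) no unfolding sweep_invar_def P_def p
            by (intro conjI exI[of _ "(x, y) # R"] exI[of _ ml]) (auto split: if_splits)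
        qed simp
      qed simp
    qed simp
  qed (simp add: try_time_def)
qed

lemma runs_sweep:
  assumes "sweep_invar m [] s" "s (flag_var k) \<noteq> Leaf"
  shows "\<exists>m'. m = Suc m' \<and> runs (sweep k c) s (sweep_time k q n) (sweep_invar m' [])"
proof -
  from assms obtain R ml where inv: "invar [] R ml s" "length R < m"
    unfolding sweep_invar_def by auto
  \<comment> \<open>The strict inequality guaranteed by the raised flag pays for this sweep.\<close>
  then obtain m' where m': "m = Suc m'" "length R \<le> m'" by (cases m) auto
  have R: "distinct R" "set R \<subseteq> X \<times> Y" using inv(1) by (auto simp: invar_def)
  have "runs (sweep k c) s (sweep_time k q n) (sweep_invar m' [])"
    unfolding sweep_def
  proof (rule runs_Seq[where b = "pairs_size n + 5" and b' = "n * n * Suc (try_time k q n) + 1" and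
        Q = "\<lambda>s'. sweep_invar m' R s' \<and> s' (todo_var k) = data_list (map entry R)"], goal_cases)
    case 1
    show ?case
    proof (rule runs_straight)
      let ?c = "Copy (todo_var k) (rest_var k) ;; Set_Leaf (rest_var k) ;; Set_Leaf (flag_var k)"
      show "cost ?c s \<le> pairs_size n + 5"
        using size_pairs(1)[OF R] inv(1) by (simp add: invar_def)
      \<comment> \<open>All open positions become untried, so the lowered flag makes only a vacuous
        claim about failures.\<close>
      have "invar R [] ml (effect ?c s)" using inv(1) by (simp add: invar_def)
      then show "sweep_invar m' R (effect ?c s) \<and>
          effect ?c s (todo_var k) = data_list (map entry R)"
        unfolding sweep_invar_def using inv(1) m'(2)
        by (intro conjI exI[of _ "[] :: ('u \<times> 'u) list"] exI[of _ ml]) (simp_all add: invar_def)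
    qed simp
  next
    case (2 s1)
    have "runs (While_Node (todo_var k) (try_position k c)) s1 (length R * Suc (try_time k q n) + 1)
        (\<lambda>s'. sweep_invar m' [] s' \<and> s' (todo_var k) = data_list (map entry []))"
      by (rule runs_foreach[where
            I = "\<lambda>T s'. sweep_invar m' T s' \<and> s' (todo_var k) = data_list (map entry T)"])
        (use 2 runs_try_position in auto)
    then show ?case
      by (rule runs_weaken)
        (use mult_le_mono1[OF length_pairs[OF R], of "Suc (try_time k q n)"] in auto)
  qed (simp add: sweep_time_def)
  with m'(1) show ?thesis by blast
qed

lemma runs_solve_game:
  assumes "s 0 = Node (data_rat \<epsilon>) (Node (data_list (map entry1 xs)) (data_list (map entry2 ys)))"
  shows "runs (solve_game k c) s (solve_time k q n)
    (\<lambda>s'. s' (flag_var k) = Leaf \<and> (\<exists>m. sweep_invar m [] s'))"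
  unfolding solve_game_def
proof (rule runs_Seq[OF runs_initialize[of s, OF assms]])
  fix s1
  let ?R = "rev (List.product xs ys)"
  assume s1: "invar [] ?R [] s1 \<and> s1 (flag_var k) \<noteq> Leaf"
  \<comment> \<open>The flag is up initially, so the variant must exceed the number of positions;
    hence \<open>Suc (n * n)\<close> in \<open>solve_time\<close>.\<close>
  then have inv: "sweep_invar (Suc (length ?R)) [] s1"
    unfolding sweep_invar_def
    by (intro exI[of _ ?R] exI[of _ "[] :: (('u \<times> 'u) \<times> 'u set \<times> 'u set) list"]) simp
  have "distinct ?R" "set ?R \<subseteq> X \<times> Y" using s1 by (auto simp: invar_def)
  from length_pairs[OF this] have len: "Suc (length ?R) \<le> Suc (n * n)" by simp
  show "runs (While_Node (flag_var k) (sweep k c)) s1 (Suc (n * n) * Suc (sweep_time k q n) + 1)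
      (\<lambda>s'. s' (flag_var k) = Leaf \<and> (\<exists>m. sweep_invar m [] s'))"
    by (rule runs_weaken[OF runs_While[where I = "\<lambda>m. sweep_invar m []", OF runs_sweep inv]])
      (use mult_le_mono1[OF len, of "Suc (sweep_time k q n)"] in auto)
qed (simp add: solve_time_def)

lemma solved_game:
  assumes "sweep_invar m [] s" "s (flag_var k) = Leaf"
  shows "winning_region_output \<Lambda> nm (\<epsilon>, (X, \<xi>), (Y, \<zeta>)) (s (won_var k))"
    and "strategy_output \<Lambda> nm (\<epsilon>, (X, \<xi>), (Y, \<zeta>)) (s (strat_var k))"
    and "data_size (s (won_var k)) \<le> pairs_size n"
    and "data_size (s (strat_var k)) \<le> strat_size q n"
proof -
  from assms obtain R ml where inv: "invar [] R ml s" "\<forall>p\<in>set R. \<not> winnable (fst ` set ml) p"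
    unfolding sweep_invar_def by auto
  obtain ds where ds: "s (strat_var k) = data_list ds" "list_all2 strat_code ds ml"
    "\<forall>d\<in>set ds. data_size d \<le> 2 * n + 2 + answer_size q n"
    using inv(1) unfolding invar_def by blast
  have won: "s (won_var k) = data_list (map name (map fst ml))"
    and dist: "distinct (map fst ml)" and sub: "set (map fst ml) \<subseteq> X \<times> Y"
    and just: "justified \<Lambda> X Y \<xi> \<zeta> (of_rat \<epsilon>) ml"
    and part: "X \<times> Y - fst ` set ml \<subseteq> set R"
    using inv(1) unfolding invar_def by auto
  \<comment> \<open>With the flag down and no untried positions, everything not won lies in
    \<open>R\<close> and failed against the final won set.\<close>
  have closed: "\<not> A \<times> (Y - B) \<subseteq> fst ` set ml"
    if "(x, y) \<in> X \<times> Y - fst ` set ml"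
      "codensity_move \<Lambda> X \<xi> Y \<zeta> (of_rat \<epsilon>) (Spoiler x y) (Duplicator A B)" for x y A B
    using winnable_iff[of x y "fst ` set ml"] inv(2) part that by blast
  have region: "spoiler_winning_region \<Lambda> X \<xi> Y \<zeta> (of_rat \<epsilon>) = fst ` set ml"
    "history_free_winning_strategy \<Lambda> X \<xi> Y \<zeta> (of_rat \<epsilon>) (map_of ml)"
    by (rule justified_closed_winning_region[OF just dist sub[unfolded set_map]],
      erule (1) closed)+
  have "code_set (code_pair (code_by nm) (code_by nm)) (s (won_var k)) (fst ` set ml)"
    unfolding won set_map[symmetric] using list_all2_name dist by (rule code_setI)
  with region(1) show "winning_region_output \<Lambda> nm (\<epsilon>, (X, \<xi>), (Y, \<zeta>)) (s (won_var k))"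
    unfolding winning_region_output_def by simp
  have "code_set strat_code (s (strat_var k)) (Map.graph (map_of ml))"
    using code_setI[OF ds(2)] ds(1) dist by (simp add: graph_map_of_if_distinct_dom distinct_map)
  with region(2) show "strategy_output \<Lambda> nm (\<epsilon>, (X, \<xi>), (Y, \<zeta>)) (s (strat_var k))"
    unfolding strategy_output_def prod.case by blast
  show "data_size (s (won_var k)) \<le> pairs_size n"
    unfolding won by (rule size_pairs(2)[OF dist sub])
  have "length ds \<le> n * n"
    using length_pairs[OF dist sub] list_all2_lengthD[OF ds(2)] by simp
  from mult_le_mono1[OF this, of "Suc (2 * n + 2 + answer_size q n)"]
  show "data_size (s (strat_var k)) \<le> strat_size q n"
    using data_size_data_list_le[of ds "2 * n + 2 + answer_size q n"] ds(1,3)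
    by (simp add: strat_size_def algebra_simps)
qed

end

section \<open>From coded inputs to the theorem\<close>

lemma game_instance_game:
  assumes "solver F \<Lambda> nm CF CL c k q" "game_instance F nm CF d (\<epsilon>, (X, \<xi>), (Y, \<zeta>))"
  obtains xs ys cx cy where "game F \<Lambda> nm CF CL c k q X Y \<xi> \<zeta> \<epsilon> xs ys cx cy (data_size d)"
    "d = Node (data_rat \<epsilon>) (Node (data_list (map (\<lambda>x. Node (nm x) (cx x)) xs))
       (data_list (map (\<lambda>y. Node (nm y) (cy y)) ys)))"
proof -
  from assms(2) obtain d1 d2 where d: "d = Node (data_rat \<epsilon>) (Node d1 d2)"
    and codes: "code_set (code_pair (code_by nm) (CF X)) d1 ((\<lambda>x. (x, \<xi> x)) ` X)"
      "code_set (code_pair (code_by nm) (CF Y)) d2 ((\<lambda>y. (y, \<zeta> y)) ` Y)"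
    and coalg: "0 \<le> \<epsilon>" "\<xi> \<in> X \<rightarrow> F X" "\<zeta> \<in> Y \<rightarrow> F Y"
    unfolding game_instance_def finite_coalgebra_def code_pair_def[of "code_by data_rat"]
      code_pair_def[of "code_set _"] by (auto simp: code_by_def)
  obtain xs cx where xs: "d1 = data_list (map (\<lambda>x. Node (nm x) (cx x)) xs)" "distinct xs"
    "set xs = X" "\<And>x. x \<in> X \<Longrightarrow> CF X (cx x) (\<xi> x)" using code_set_graph[OF codes(1)] by metis
  obtain ys cy where ys: "d2 = data_list (map (\<lambda>y. Node (nm y) (cy y)) ys)" "distinct ys"
    "set ys = Y" "\<And>y. y \<in> Y \<Longrightarrow> CF Y (cy y) (\<zeta> y)" using code_set_graph[OF codes(2)] by metis
  have "game F \<Lambda> nm CF CL c k q X Y \<xi> \<zeta> \<epsilon> xs ys cx cy (data_size d)"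
    using assms(1) coalg xs ys by (intro game.intro game_axioms.intro) (auto simp: d)
  then show ?thesis using that d xs(1) ys(1) by blast
qed

lemma poly_time_computableI:
  assumes "poly_bounded f"
    and "\<And>d i. inp d i \<Longrightarrow> runs c (initial_store d) (f (data_size d)) (\<lambda>s. sol i (s 0))"
  shows "poly_time_computable inp sol"
proof -
  from assms(1) obtain p where "\<And>n. f n \<le> poly p n" unfolding poly_bounded_def by blast
  with assms(2) show ?thesis
    unfolding poly_time_computable_def runs_def by (meson le_trans)
qed

theorem theorem4p6:
  fixes F :: "'u set \<Rightarrow> 'f set"
    and Fm :: "'u set \<Rightarrow> 'u set \<Rightarrow> ('u \<Rightarrow> 'u) \<Rightarrow> 'f \<Rightarrow> 'f"
    and \<Lambda> :: "('u, 'f) lifting set"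
    and nm :: "'u \<Rightarrow> data"
    and CF :: "'u set \<Rightarrow> 'f coding"
    and CL :: "('u, 'f) lifting coding"
  assumes "set_functor F Fm"
    and "\<And>l. l \<in> \<Lambda> \<Longrightarrow> monotone_predicate_lifting F Fm l"
    and "inj nm" and "\<And>X. right_unique (CF X)" and "right_unique CL"
    and "poly_time_solvable F \<Lambda> nm CF CL"
  shows "poly_time_computable (game_instance F nm CF) (winning_region_output \<Lambda> nm) \<and>
         poly_time_computable (game_instance F nm CF) (strategy_output \<Lambda> nm)"
proof -
  from assms(6) obtain c q where "\<And>d i. solver_instance F nm CF d i \<Longrightarrow>
      \<exists>t s. exec c (initial_store d) t s \<and> t \<le> poly q (data_size d) \<and> solver_output \<Lambda> nm CL i (s 0)"
    unfolding poly_time_solvable_def poly_time_computable_def by blast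
  then have solver: "solver F \<Lambda> nm CF CL c (max_var c) q" by unfold_locales auto
  let ?k = "max_var c"
  \<comment> \<open>One run produces both results; the two programs differ only in the list that
    they finally copy to variable 0. The size bounds keep that copy polynomial.\<close>
  have run: "runs (solve_game ?k c) (initial_store d) (solve_time ?k q (data_size d))
      (\<lambda>s. winning_region_output \<Lambda> nm i (s (won_var ?k)) \<and>
         strategy_output \<Lambda> nm i (s (strat_var ?k)) \<and>
         data_size (s (won_var ?k)) \<le> pairs_size (data_size d) \<and>
         data_size (s (strat_var ?k)) \<le> strat_size q (data_size d))"
    if "game_instance F nm CF d i" for d i
  proof -
    obtain \<epsilon> X \<xi> Y \<zeta> where i: "i = (\<epsilon>, (X, \<xi>), (Y, \<zeta>))" by (metis prod.exhaust)
    from game_instance_game[OF solver that[unfolded i]] obtain xs ys cx cy where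
      game: "game F \<Lambda> nm CF CL c ?k q X Y \<xi> \<zeta> \<epsilon> xs ys cx cy (data_size d)" and
      d: "d = Node (data_rat \<epsilon>) (Node (data_list (map (\<lambda>x. Node (nm x) (cx x)) xs))
         (data_list (map (\<lambda>y. Node (nm y) (cy y)) ys)))" by blast
    interpret game F \<Lambda> nm CF CL c ?k q X Y \<xi> \<zeta> \<epsilon> xs ys cx cy "data_size d" by (rule game)
    show ?thesis
      unfolding i
      by (rule runs_weaken[OF runs_solve_game]) (use solved_game d in \<open>auto simp: initial_store_def\<close>)
  qed
  have copy: "runs (Copy 0 v) s (Suc m) (\<lambda>s'. sol (s' 0))"
    if "sol (s v)" "data_size (s v) \<le> m" for v s m and sol :: "data \<Rightarrow> bool"
    by (rule runs_straight) (use that in auto)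
  show ?thesis
  proof
    show "poly_time_computable (game_instance F nm CF) (winning_region_output \<Lambda> nm)"
      by (rule poly_time_computableI[where f = "\<lambda>n. solve_time ?k q n + Suc (pairs_size n)"
            and c = "solve_game ?k c ;; Copy 0 (won_var ?k)"],
          intro poly_bounded_intros poly_bounded_solve, rule runs_Seq[OF run])
        (auto intro: copy)
    show "poly_time_computable (game_instance F nm CF) (strategy_output \<Lambda> nm)"
      by (rule poly_time_computableI[where f = "\<lambda>n. solve_time ?k q n + Suc (strat_size q n)"
            and c = "solve_game ?k c ;; Copy 0 (strat_var ?k)"],
          intro poly_bounded_intros poly_bounded_solve, rule runs_Seq[OF run])
        (auto intro: copy)
  qed
qed

end
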